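(* Let $M$ be a module over the Lie algebra $\mathfrak{L}$ such that the restriction of $M$ to the subalgebra $U(\mathbb{C}L_0\oplus\mathbb{C}M_0)$ of $U(\mathfrak{L})$ is free of rank one. Then there exist $\lambda\in\mathbb{C}^*$, $\alpha,\beta,\gamma\in\mathbb{C}$ and $h(t)\in\mathbb{C}[t]$ such that $M\cong\Phi(\lambda,\alpha,\beta,\gamma,h(t))$ as $\mathfrak{L}$-modules.
   Context: All vector spaces are over $\mathbb{C}$; $\mathbb{C}^*$ is the set of nonzero complex numbers; $U(\mathfrak{g})$ denotes the universal enveloping algebra of a Lie algebra $\mathfrak{g}$. The BMS-Kac-Moody algebra $\mathfrak{L}$ is the complex Lie algebra with basis $\{L_m,M_m,S_m,I_m\mid m\in\mathbb{Z}\}$ and nontrivial brackets, for all $m,n\in\mathbb{Z}$, $$[L_m,L_n]=(n-m)L_{m+n},\quad [L_m,M_n]=(n-m)M_{m+n},\quad [L_m,S_n]=nS_{m+n},$$ $$[L_m,I_n]=nI_{m+n},\quad [M_m,I_n]=-nS_{m+n}$$ (all other brackets between basis elements, apart from those determined by skew-symmetry, are zero). In particular $L_0$ and $M_0$ commute, so $\mathbb{C}L_0\oplus\mathbb{C}M_0$ is an abelian subalgebra. For $\lambda\in\mathbb{C}^*$, $\alpha,\beta,\gamma\in\mathbb{C}$ and $h(t)\in\mathbb{C}[t]$, set for $m\in\mathbb{Z}$ $$h_m(t)=m h(t)-m(m-1)\alpha\frac{h(t)-h(\alpha)}{t-\alpha}\in\mathbb{C}[t].$$ The $\mathfrak{L}$-module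 $\Phi(\lambda,\alpha,\beta,\gamma,h(t))$ is the vector space $\mathbb{C}[s,t]$ with the action, for $f(s,t)\in\mathbb{C}[s,t]$ and $m\in\mathbb{Z}$, $$L_m\cdot f(s,t)=\lambda^m(s+h_m(t))f(s-m,t)-m\lambda^m(t-m\alpha)\frac{\partial}{\partial t}\big(f(s-m,t)\big),$$ $$M_m\cdot f(s,t)=\lambda^m(t-m\alpha)f(s-m,t),\qquad S_m\cdot f(s,t)=\lambda^m\beta f(s-m,t),$$ $$I_m\cdot f(s,t)=\lambda^m\Big(\gamma-m\beta\frac{h(t)-h(\alpha)}{t-\alpha}\Big)f(s-m,t)+m\lambda^m\beta\frac{\partial}{\partial t}\big(f(s-m,t)\big).$$ *)

theory Defs
  imports "HOL-Algebra.QuotRing" "HOL-Library.Poly_Mapping"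
    "HOL-Computational_Algebra.Polynomial"
begin

section \<open>Finitely supported families\<close>

text \<open>\<open>'i \<Rightarrow>\<^sub>0 complex\<close> is the complex vector space with basis the
  vectors \<open>bvec i\<close>, where \<open>i\<close> ranges over the type \<open>'i\<close>.\<close>

definition fs_scale :: "complex \<Rightarrow> ('i \<Rightarrow>\<^sub>0 complex) \<Rightarrow> ('i \<Rightarrow>\<^sub>0 complex)" where
  "fs_scale c x = Poly_Mapping.map ((*) c) x"

abbreviation bvec :: "'i \<Rightarrow> ('i \<Rightarrow>\<^sub>0 complex)" where
  "bvec i \<equiv> Poly_Mapping.single i 1"

text \<open>The linear map on \<open>'i \<Rightarrow>\<^sub>0 complex\<close> taking the value \<open>f i\<close> at
  \<open>bvec i\<close>.\<close>

definition lin_ext ::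
    "(complex \<Rightarrow> 'v \<Rightarrow> 'v) \<Rightarrow> ('i \<Rightarrow> 'v) \<Rightarrow> ('i \<Rightarrow>\<^sub>0 complex) \<Rightarrow> 'v::comm_monoid_add" where
  "lin_ext scale f x =
     (\<Sum>i\<in>Poly_Mapping.keys x. scale (Poly_Mapping.lookup x i) (f i))"

lemma lookup_fs_scale [simp]:
  "Poly_Mapping.lookup (fs_scale c x) i = c * Poly_Mapping.lookup x i"
  by (simp add: fs_scale_def Poly_Mapping.map.rep_eq when_def)

lemma fs_scale_single [simp]: "fs_scale c (Poly_Mapping.single i d) = Poly_Mapping.single i (c * d)"
  by (rule poly_mapping_eqI) (simp add: lookup_single when_def)

lemma vector_space_fs_scale: "vector_space fs_scale"
  by unfold_locales (auto intro!: poly_mapping_eqI simp: lookup_add algebra_simps)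

lemma lin_ext_superset:
  assumes "vector_space scale" "finite A" "Poly_Mapping.keys x \<subseteq> A"
  shows "lin_ext scale f x = (\<Sum>i\<in>A. scale (Poly_Mapping.lookup x i) (f i))"
proof -
  interpret vector_space scale by fact
  show ?thesis unfolding lin_ext_def
    by (rule sum.mono_neutral_left) (use assms in \<open>auto simp: in_keys_iff\<close>)
qed

lemma lin_ext_add:
  assumes "vector_space scale"
  shows "lin_ext scale f (x + y) = lin_ext scale f x + lin_ext scale f y"
proof -
  interpret vector_space scale by fact
  let ?A = "Poly_Mapping.keys x \<union> Poly_Mapping.keys y"
  have "finite ?A" by simp
  moreover have "Poly_Mapping.keys (x + y) \<subseteq> ?A" by (rule Poly_Mapping.keys_add)
  ultimately show ?thesis
    by (simp add: lin_ext_superset[OF assms, of ?A] lookup_add scale_left_distrib sum.distrib)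
qed

lemma lin_ext_scale:
  assumes "vector_space scale"
  shows "lin_ext scale f (fs_scale c x) = scale c (lin_ext scale f x)"
proof -
  interpret vector_space scale by fact
  have "Poly_Mapping.keys (fs_scale c x) \<subseteq> Poly_Mapping.keys x"
    by (auto simp: in_keys_iff)
  then show ?thesis
    by (simp add: lin_ext_superset[OF assms, of "Poly_Mapping.keys x"] scale_sum_right)
qed

lemma lin_ext_zero [simp]: "lin_ext scale f 0 = 0"
  by (simp add: lin_ext_def)

lemma lin_ext_single [simp]:
  assumes "vector_space scale"
  shows "lin_ext scale f (Poly_Mapping.single i c) = scale c (f i)"
proof -
  interpret vector_space scale by fact
  show ?thesis by (simp add: lin_ext_def)
qed

lemma lin_ext_diff:
  assumes "vector_space scale"
  shows "lin_ext scale f (x - y) = lin_ext scale f x - lin_ext scale f y"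
  by (metis add_diff_cancel_right' assms diff_add_cancel lin_ext_add)

lemma fs_induct [case_names zero single add]:
  assumes "P 0" and s: "\<And>i c. P (Poly_Mapping.single i c)"
    and a: "\<And>x y. P x \<Longrightarrow> P y \<Longrightarrow> P (x + y)"
  shows "P (x :: 'i \<Rightarrow>\<^sub>0 complex)"
proof -
  have "P (\<Sum>i\<in>A. Poly_Mapping.single i (Poly_Mapping.lookup x i))" if "finite A" for A
    using that by induction (auto simp: assms)
  moreover have "x = (\<Sum>i\<in>Poly_Mapping.keys x. Poly_Mapping.single i (Poly_Mapping.lookup x i))"
    by (rule poly_mapping_eqI) (auto simp: lookup_sum lookup_single when_def in_keys_iff)
  ultimately show ?thesis by (metis finite_keys)
qed


section \<open>Lie algebras and universal enveloping algebras\<close>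

locale lie_algebra = vector_space scale
  for scale :: "complex \<Rightarrow> 'g::ab_group_add \<Rightarrow> 'g" +
  fixes bracket :: "'g \<Rightarrow> 'g \<Rightarrow> 'g"
  assumes bracket_add_left: "bracket (x + y) z = bracket x z + bracket y z"
    and bracket_add_right: "bracket x (y + z) = bracket x y + bracket x z"
    and bracket_scale_left: "bracket (scale c x) y = scale c (bracket x y)"
    and bracket_scale_right: "bracket x (scale c y) = scale c (bracket x y)"
    and bracket_self: "bracket x x = 0"
    and jacobi: "bracket x (bracket y z) + bracket y (bracket z x) + bracket z (bracket x y) = 0"

text \<open>The monoid of words is written additively because multiplication on
  \<open>'a \<Rightarrow>\<^sub>0 'b\<close> is convolution with respect to \<open>+\<close> on \<open>'a\<close>; hence
  \<open>'g word \<Rightarrow>\<^sub>0 complex\<close> is the free associative unital algebra on \<open>'g\<close>.\<close>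

datatype 'g word = Word (letters: "'g list")

instantiation word :: (type) monoid_add
begin
definition "0 = Word []"
definition "v + w = Word (letters v @ letters w)"
instance
  by standard (auto simp: zero_word_def plus_word_def)
end

definition free_algebra :: "'g set \<Rightarrow> ('g word \<Rightarrow>\<^sub>0 complex) ring" where
  "free_algebra H =
     \<lparr>carrier = {p. \<forall>w\<in>Poly_Mapping.keys p. set (letters w) \<subseteq> H},
      monoid.mult = (*), one = 1, zero = 0, add = (+)\<rparr>"

context lie_algebra
begin

text \<open>For a Lie subalgebra \<open>H\<close>, \<open>enveloping_algebra H\<close> is the universal enveloping algebra
  \<open>U(H)\<close>. The first two families of relations turn the free algebra on the set \<open>H\<close> into the
  tensor algebra of the vector space \<open>H\<close>.\<close>

definition enveloping_relations :: "'g set \<Rightarrow> ('g word \<Rightarrow>\<^sub>0 complex) set" where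
  "enveloping_relations H =
     {bvec (Word [x + y]) - bvec (Word [x]) - bvec (Word [y]) | x y. x \<in> H \<and> y \<in> H} \<union>
     {bvec (Word [scale c x]) - fs_scale c (bvec (Word [x])) | c x. x \<in> H} \<union>
     {bvec (Word [x, y]) - bvec (Word [y, x]) - bvec (Word [bracket x y]) | x y. x \<in> H \<and> y \<in> H}"

definition enveloping_algebra :: "'g set \<Rightarrow> ('g word \<Rightarrow>\<^sub>0 complex) set ring" where
  "enveloping_algebra H =
     free_algebra H Quot (Idl\<^bsub>free_algebra H\<^esub> (enveloping_relations H))"

end


section \<open>Modules over a Lie algebra\<close>

locale lie_module =
  lie_algebra scale_g bracket + V: vector_space scale_v
  for scale_g :: "complex \<Rightarrow> 'g::ab_group_add \<Rightarrow> 'g" and bracket :: "'g \<Rightarrow> 'g \<Rightarrow> 'g"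
    and scale_v :: "complex \<Rightarrow> 'v::ab_group_add \<Rightarrow> 'v" +
  fixes act :: "'g \<Rightarrow> 'v \<Rightarrow> 'v"
  assumes act_add_left: "act (x + y) v = act x v + act y v"
    and act_add_right: "act x (v + w) = act x v + act x w"
    and act_scale_left: "act (scale_g c x) v = scale_v c (act x v)"
    and act_scale_right: "act x (scale_v c v) = scale_v c (act x v)"
    and act_bracket: "act (bracket x y) v = act x (act y v) - act y (act x v)"
begin

definition free_act :: "('g word \<Rightarrow>\<^sub>0 complex) \<Rightarrow> 'v \<Rightarrow> 'v" where
  "free_act p v = lin_ext scale_v (\<lambda>w. foldr act (letters w) v) p"

text \<open>The induced action of \<open>U(H)\<close>, whose elements are cosets. It does not depend on the
  chosen representative, see \<open>env_act_coset\<close> below.\<close>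

definition env_act :: "('g word \<Rightarrow>\<^sub>0 complex) set \<Rightarrow> 'v \<Rightarrow> 'v" where
  "env_act u v = free_act (SOME p. p \<in> u) v"

text \<open>The restriction of the module to \<open>U(H)\<close> is free of rank one: it has a one-element basis
  \<open>{v}\<close>, i.e. every element is \<open>u \<cdot> v\<close> for a unique \<open>u \<in> U(H)\<close>.\<close>

definition free_rank_one_over :: "'g set \<Rightarrow> bool" where
  "free_rank_one_over H \<longleftrightarrow>
     (\<exists>v. bij_betw (\<lambda>u. env_act u v) (carrier (enveloping_algebra H)) UNIV)"

end

definition lie_module_isomorphic ::
    "(complex \<Rightarrow> 'v::ab_group_add \<Rightarrow> 'v) \<Rightarrow> ('g \<Rightarrow> 'v \<Rightarrow> 'v) \<Rightarrow>
     (complex \<Rightarrow> 'w::ab_group_add \<Rightarrow> 'w) \<Rightarrow> ('g \<Rightarrow> 'w \<Rightarrow> 'w) \<Rightarrow> bool" where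
  "lie_module_isomorphic scale_v act_v scale_w act_w \<longleftrightarrow>
     (\<exists>\<phi>. Vector_Spaces.linear scale_v scale_w \<phi> \<and> bij \<phi> \<and>
          (\<forall>x v. \<phi> (act_v x v) = act_w x (\<phi> v)))"


subsection \<open>The action of the enveloping algebra is well defined\<close>

lemma ring_free_algebra: "ring (free_algebra H)"
proof (rule ringI)
  let ?F = "{p :: 'a word \<Rightarrow>\<^sub>0 complex. \<forall>w\<in>Poly_Mapping.keys p. set (letters w) \<subseteq> H}"
  have add: "p + q \<in> ?F" if "p \<in> ?F" "q \<in> ?F" for p q
    using that Poly_Mapping.keys_add[of p q] by blast
  have mul: "p * q \<in> ?F" if "p \<in> ?F" "q \<in> ?F" for p q
  proof -
    have "set (letters (v + w)) \<subseteq> H" if "v \<in> Poly_Mapping.keys p" "w \<in> Poly_Mapping.keys q" for v w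
      using that \<open>p \<in> ?F\<close> \<open>q \<in> ?F\<close> by (auto simp: plus_word_def)
    then show ?thesis using Poly_Mapping.keys_mult[of p q] by blast
  qed
  show "abelian_group (free_algebra H)"
  proof (rule abelian_groupI)
    fix p assume p: "p \<in> carrier (free_algebra H)"
    have "- p \<in> carrier (free_algebra H)" "- p + p = 0"
      using p by (auto simp: free_algebra_def in_keys_iff)
    then show "\<exists>q\<in>carrier (free_algebra H). q \<oplus>\<^bsub>free_algebra H\<^esub> p = \<zero>\<^bsub>free_algebra H\<^esub>"
      by (intro bexI[of _ "- p"]) (auto simp: free_algebra_def)
  next
    show "p \<oplus>\<^bsub>free_algebra H\<^esub> q \<in> carrier (free_algebra H)"
      if "p \<in> carrier (free_algebra H)" "q \<in> carrier (free_algebra H)" for p q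
      using add that by (simp only: free_algebra_def ring_record_simps partial_object.simps)
  qed (simp_all add: free_algebra_def add.assoc add.commute)
  show "Group.monoid (free_algebra H)"
  proof (rule monoidI)
    show "p \<otimes>\<^bsub>free_algebra H\<^esub> q \<in> carrier (free_algebra H)"
      if "p \<in> carrier (free_algebra H)" "q \<in> carrier (free_algebra H)" for p q
      using mul that by (simp only: free_algebra_def ring_record_simps monoid.simps partial_object.simps)
  qed (simp_all add: free_algebra_def mult.assoc zero_word_def)
qed (simp_all add: free_algebra_def distrib_left distrib_right)

context lie_module
begin

lemma free_act_add: "free_act (p + q) v = free_act p v + free_act q v"
  by (simp add: free_act_def lin_ext_add[OF V.vector_space_axioms])

lemma free_act_diff: "free_act (p - q) v = free_act p v - free_act q v"
  by (simp add: free_act_def lin_ext_diff[OF V.vector_space_axioms])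

lemma free_act_single: "free_act (Poly_Mapping.single w c) v = scale_v c (foldr act (letters w) v)"
  by (simp add: free_act_def lin_ext_single[OF V.vector_space_axioms])

lemma free_act_zero [simp]: "free_act 0 v = 0"
  by (simp add: free_act_def)

lemma act_zero_right [simp]: "act x 0 = 0"
  using act_add_right[of x 0 0] by simp

lemma foldr_act_add: "foldr act xs (v + w) = foldr act xs v + foldr act xs w"
  by (induction xs) (auto simp: act_add_right)

lemma foldr_act_scale: "foldr act xs (scale_v c v) = scale_v c (foldr act xs v)"
  by (induction xs) (auto simp: act_scale_right)

lemma foldr_act_zero: "foldr act xs 0 = 0"
  by (induction xs) auto

lemma free_act_add_right: "free_act p (v + w) = free_act p v + free_act p w"
  by (simp add: free_act_def lin_ext_def foldr_act_add V.scale_right_distrib sum.distrib)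

lemma free_act_zero_right [simp]: "free_act p 0 = 0"
  by (simp add: free_act_def lin_ext_def foldr_act_zero)

lemma free_act_mult: "free_act (p * q) v = free_act p (free_act q v)"
proof (induction p rule: fs_induct)
  case (single w c)
  show ?case
  proof (induction q rule: fs_induct)
    case (single u d)
    show ?case
      by (simp add: mult_single free_act_single plus_word_def foldr_act_scale)
  qed (auto simp: distrib_left free_act_add free_act_add_right)
qed (auto simp: distrib_right free_act_add)

lemma free_act_relations:
  assumes "p \<in> enveloping_relations H"
  shows "free_act p v = 0"
  using assms
  by (auto simp: enveloping_relations_def free_act_diff free_act_single
      act_add_left act_scale_left act_bracket)

lemma free_act_ideal:
  assumes "p \<in> Idl\<^bsub>free_algebra H\<^esub> (enveloping_relations H)" and H: "module.subspace scale_g H"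
    and cl: "\<And>x y. x \<in> H \<Longrightarrow> y \<in> H \<Longrightarrow> bracket x y \<in> H"
  shows "free_act p v = 0"
proof -
  interpret F: ring "free_algebra H" by (rule ring_free_algebra)
  let ?K = "{p \<in> carrier (free_algebra H). \<forall>v. free_act p v = 0}"
  have neg: "\<ominus>\<^bsub>free_algebra H\<^esub> p = - p" if "p \<in> carrier (free_algebra H)" for p
  proof (rule F.minus_equality[symmetric, THEN sym])
    show "- p \<oplus>\<^bsub>free_algebra H\<^esub> p = \<zero>\<^bsub>free_algebra H\<^esub>" by (simp add: free_algebra_def)
    show "- p \<in> carrier (free_algebra H)"
      using that by (auto simp: free_algebra_def in_keys_iff)
  qed fact
  have free_act_minus: "free_act (- p) v = - free_act p v" for p v
    using free_act_diff[of 0 p v] by simp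
  have "ideal ?K (free_algebra H)"
  proof (rule idealI)
    show "subgroup ?K (add_monoid (free_algebra H))"
    proof (rule F.add.subgroupI)
      show "\<ominus>\<^bsub>free_algebra H\<^esub> a \<in> ?K" if "a \<in> ?K" for a
        using that F.a_inv_closed[of a] by (auto simp: neg free_act_minus)
      show "a \<oplus>\<^bsub>free_algebra H\<^esub> b \<in> ?K" if "a \<in> ?K" "b \<in> ?K" for a b
        using that F.a_closed[of a b] by (auto simp: free_algebra_def free_act_add)
      have "\<zero>\<^bsub>free_algebra H\<^esub> \<in> ?K" using F.zero_closed by (auto simp: free_algebra_def)
      then show "?K \<noteq> {}" by blast
    qed auto
    show "x \<otimes>\<^bsub>free_algebra H\<^esub> a \<in> ?K" "a \<otimes>\<^bsub>free_algebra H\<^esub> x \<in> ?K"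
      if "a \<in> ?K" "x \<in> carrier (free_algebra H)" for a x
      using that F.m_closed[of x a] F.m_closed[of a x]
      by (auto simp: free_algebra_def free_act_mult)
  qed (rule ring_free_algebra)
  moreover have "enveloping_relations H \<subseteq> ?K"
  proof
    fix p assume p: "p \<in> enveloping_relations H"
    have sub: "bvec (Word xs) \<in> carrier (free_algebra H)" if "set xs \<subseteq> H" for xs
      using that by (auto simp: free_algebra_def)
    have sc: "Poly_Mapping.single (Word xs) c \<in> carrier (free_algebra H)" if "set xs \<subseteq> H" for xs c
      using that by (auto simp: free_algebra_def)
    have diff: "p - q \<in> carrier (free_algebra H)"
      if "p \<in> carrier (free_algebra H)" "q \<in> carrier (free_algebra H)" for p q
    proof -
      have "Poly_Mapping.keys (p - q) \<subseteq> Poly_Mapping.keys p \<union> Poly_Mapping.keys q"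
        by (auto simp: in_keys_iff lookup_minus)
      then show ?thesis using that by (auto simp: free_algebra_def)
    qed
    have "p \<in> carrier (free_algebra H)"
      using p H[THEN subspace_add] H[THEN subspace_scale] cl
      by (auto simp: enveloping_relations_def intro!: diff sc)
    then show "p \<in> ?K" using free_act_relations[OF p] by auto
  qed
  ultimately have "Idl\<^bsub>free_algebra H\<^esub> (enveloping_relations H) \<subseteq> ?K"
    by (auto simp: genideal_def)
  then show ?thesis using assms(1) by auto
qed

lemma env_act_coset:
  assumes H: "module.subspace scale_g H" "\<And>x y. x \<in> H \<Longrightarrow> y \<in> H \<Longrightarrow> bracket x y \<in> H"
  shows "env_act (Idl\<^bsub>free_algebra H\<^esub> (enveloping_relations H) +>\<^bsub>free_algebra H\<^esub> p) v
    = free_act p v"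
proof -
  let ?I = "Idl\<^bsub>free_algebra H\<^esub> (enveloping_relations H)"
  have coset: "?I +>\<^bsub>free_algebra H\<^esub> p = {j + p | j. j \<in> ?I}"
    by (auto simp: a_r_coset_def' free_algebra_def)
  have "\<exists>q. q \<in> ?I +>\<^bsub>free_algebra H\<^esub> p"
  proof -
    have "0 \<in> ?I"
      by (auto simp: genideal_def free_algebra_def dest!: ideal.axioms(1) additive_subgroup.zero_closed)
    then show ?thesis unfolding coset by blast
  qed
  then have "(SOME q. q \<in> ?I +>\<^bsub>free_algebra H\<^esub> p) \<in> ?I +>\<^bsub>free_algebra H\<^esub> p"
    by (rule someI_ex)
  then obtain j where "(SOME q. q \<in> ?I +>\<^bsub>free_algebra H\<^esub> p) = j + p" "j \<in> ?I"
    unfolding coset by blast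
  then show ?thesis
    by (simp add: env_act_def free_act_add free_act_ideal[OF _ H])
qed

end


section \<open>The BMS-Kac-Moody algebra\<close>

datatype bms_basis = BL int | BM int | BS int | BI int

type_synonym bms = "bms_basis \<Rightarrow>\<^sub>0 complex"

fun basis_bracket :: "bms_basis \<Rightarrow> bms_basis \<Rightarrow> bms" where
  "basis_bracket (BL m) (BL n) = Poly_Mapping.single (BL (m + n)) (of_int (n - m))"
| "basis_bracket (BL m) (BM n) = Poly_Mapping.single (BM (m + n)) (of_int (n - m))"
| "basis_bracket (BL m) (BS n) = Poly_Mapping.single (BS (m + n)) (of_int n)"
| "basis_bracket (BL m) (BI n) = Poly_Mapping.single (BI (m + n)) (of_int n)"
| "basis_bracket (BM m) (BI n) = Poly_Mapping.single (BS (m + n)) (of_int (- n))"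
| "basis_bracket (BM n) (BL m) = Poly_Mapping.single (BM (m + n)) (- of_int (n - m))"
| "basis_bracket (BS n) (BL m) = Poly_Mapping.single (BS (m + n)) (- of_int n)"
| "basis_bracket (BI n) (BL m) = Poly_Mapping.single (BI (m + n)) (- of_int n)"
| "basis_bracket (BI n) (BM m) = Poly_Mapping.single (BS (m + n)) (- of_int (- n))"
| "basis_bracket _ _ = 0"

definition bms_bracket :: "bms \<Rightarrow> bms \<Rightarrow> bms" where
  "bms_bracket x y = lin_ext fs_scale (\<lambda>i. lin_ext fs_scale (basis_bracket i) y) x"

lemma basis_bracket_skew: "basis_bracket i j = - basis_bracket j i"
  by (cases i; cases j) (auto simp: add.commute single_uminus[symmetric])

lemma bms_bracket_add_left: "bms_bracket (x + y) z = bms_bracket x z + bms_bracket y z"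
  by (simp add: bms_bracket_def lin_ext_add[OF vector_space_fs_scale])

lemma bms_bracket_scale_left: "bms_bracket (fs_scale c x) z = fs_scale c (bms_bracket x z)"
  by (simp add: bms_bracket_def lin_ext_scale[OF vector_space_fs_scale])

lemma bms_bracket_add_right: "bms_bracket x (y + z) = bms_bracket x y + bms_bracket x z"
proof -
  interpret vector_space "fs_scale :: _ \<Rightarrow> bms \<Rightarrow> _" by (rule vector_space_fs_scale)
  show ?thesis
    unfolding bms_bracket_def lin_ext_add[OF vector_space_fs_scale]
    by (simp add: lin_ext_def[of _ _ x] sum.distrib scale_right_distrib)
qed

lemma bms_bracket_single:
  "bms_bracket (Poly_Mapping.single i c) (Poly_Mapping.single j d) =
    fs_scale (c * d) (basis_bracket i j)"
proof -
  interpret vector_space "fs_scale :: _ \<Rightarrow> bms \<Rightarrow> _" by (rule vector_space_fs_scale)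
  show ?thesis
    by (simp add: bms_bracket_def lin_ext_single[OF vector_space_fs_scale])
qed

lemma bms_bracket_zero_left [simp]: "bms_bracket 0 y = 0"
  by (simp add: bms_bracket_def)

lemma bms_bracket_zero_right [simp]: "bms_bracket x 0 = 0"
  using bms_bracket_add_right[of x 0 0] by simp

lemma fs_scale_uminus: "fs_scale c (- x) = - fs_scale c x"
  by (rule poly_mapping_eqI) simp

lemma bms_bracket_skew: "bms_bracket x y = - bms_bracket y x"
proof (induction x rule: fs_induct)
  case (single i c)
  show ?case
  proof (induction y rule: fs_induct)
    case (single j d)
    show ?case
      using basis_bracket_skew[of i j]
      by (simp add: bms_bracket_single fs_scale_uminus mult.commute)
  qed (auto simp: bms_bracket_add_left bms_bracket_add_right)
qed (auto simp: bms_bracket_add_left bms_bracket_add_right)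

lemma bms_bracket_scale_right: "bms_bracket x (fs_scale c z) = fs_scale c (bms_bracket x z)"
  by (metis bms_bracket_skew bms_bracket_scale_left fs_scale_uminus)

lemma bms_bracket_self: "bms_bracket x x = 0"
proof (rule poly_mapping_eqI)
  fix i
  have "Poly_Mapping.lookup (bms_bracket x x) i = - Poly_Mapping.lookup (bms_bracket x x) i"
    by (metis bms_bracket_skew lookup_uminus)
  then show "Poly_Mapping.lookup (bms_bracket x x) i = Poly_Mapping.lookup 0 i" by simp
qed

lemma bms_jacobi_basis:
  "bms_bracket (bvec i) (bms_bracket (bvec j) (bvec k)) +
   bms_bracket (bvec j) (bms_bracket (bvec k) (bvec i)) +
   bms_bracket (bvec k) (bms_bracket (bvec i) (bvec j)) = 0"
proof -
  interpret vector_space "fs_scale :: _ \<Rightarrow> bms \<Rightarrow> _" by (rule vector_space_fs_scale)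
  show ?thesis
    by (cases i; cases j; cases k)
      (auto simp: bms_bracket_single single_add[symmetric] algebra_simps)
qed

lemma bms_jacobi:
  "bms_bracket x (bms_bracket y z) + bms_bracket y (bms_bracket z x)
   + bms_bracket z (bms_bracket x y) = 0"
proof -
  interpret vector_space "fs_scale :: _ \<Rightarrow> bms \<Rightarrow> _" by (rule vector_space_fs_scale)
  define J where "J x y z = bms_bracket x (bms_bracket y z) + bms_bracket y (bms_bracket z x)
    + bms_bracket z (bms_bracket x y)" for x y z
  have add: "J (x + x') y z = J x y z + J x' y z" "J x (y + y') z = J x y z + J x y' z"
    "J x y (z + z') = J x y z + J x y z'" for x x' y y' z z'
    by (simp_all add: J_def bms_bracket_add_left bms_bracket_add_right algebra_simps)
  have single: "J (Poly_Mapping.single i a) (Poly_Mapping.single j b) (Poly_Mapping.single k c) = 0"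
    for i j k a b c
  proof -
    have s: "Poly_Mapping.single i a = fs_scale a (bvec i)"
      "Poly_Mapping.single j b = fs_scale b (bvec j)"
      "Poly_Mapping.single k c = fs_scale c (bvec k)" by simp_all
    have "J (fs_scale a (bvec i)) (fs_scale b (bvec j)) (fs_scale c (bvec k)) =
        fs_scale (a * b * c) (J (bvec i) (bvec j) (bvec k))"
      unfolding J_def bms_bracket_scale_left bms_bracket_scale_right
      by (simp only: scale_right_distrib scale_scale ac_simps)
    then show ?thesis
      unfolding s by (simp only: J_def bms_jacobi_basis scale_zero_right)
  qed
  have zero: "J 0 y z = 0" "J x 0 z = 0" "J x y 0 = 0" for x y z
    by (simp_all add: J_def)
  have "J x (Poly_Mapping.single j b) (Poly_Mapping.single k c) = 0" for x j b k c
    by (induction x rule: fs_induct) (simp_all add: single add zero)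
  then have "J x y (Poly_Mapping.single k c) = 0" for x y k c
    by (induction y rule: fs_induct) (simp_all add: add zero)
  then have "J x y z = 0"
    by (induction z rule: fs_induct) (simp_all add: add zero)
  then show ?thesis by (simp add: J_def)
qed

interpretation bms: lie_algebra fs_scale bms_bracket
  by (intro lie_algebra.intro vector_space_fs_scale lie_algebra_axioms.intro
      bms_bracket_add_left bms_bracket_add_right bms_bracket_scale_left bms_bracket_scale_right
      bms_bracket_self bms_jacobi)

definition L0_M0_span :: "bms set" where
  "L0_M0_span = bms.span {bvec (BL 0), bvec (BM 0)}"


section \<open>The modules \<open>\<Phi>(\<lambda>, \<alpha>, \<beta>, \<gamma>, h(t))\<close>\<close>

text \<open>\<open>\<complex>[s,t]\<close> is represented by \<open>complex poly poly\<close>: the outer variable is \<open>s\<close>, and the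
  coefficients are polynomials in \<open>t\<close>. Thus \<open>smult p f\<close> is \<open>p(t) f(s,t)\<close>, \<open>smult [:c:] f\<close> is the
  scalar multiple \<open>c f(s,t)\<close>, and \<open>[:p, 1:]\<close> is \<open>s + p(t)\<close> when \<open>p\<close> is in \<open>\<complex>[t]\<close>.
  The argument \<open>l\<close> below is the parameter \<open>\<lambda>\<close>.\<close>

definition shift_s :: "int \<Rightarrow> complex poly poly \<Rightarrow> complex poly poly" where
  "shift_s m f = pcompose f [:- of_int m, 1:]"

definition deriv_t :: "complex poly poly \<Rightarrow> complex poly poly" where
  "deriv_t f = map_poly pderiv f"

text \<open>\<open>(h(t) - h(\<alpha>)) / (t - \<alpha>)\<close>; the division is exact.\<close>

definition diff_quot :: "complex \<Rightarrow> complex poly \<Rightarrow> complex poly" where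
  "diff_quot \<alpha> h = (h - [:poly h \<alpha>:]) div [:- \<alpha>, 1:]"

definition h_seq :: "complex \<Rightarrow> complex poly \<Rightarrow> int \<Rightarrow> complex poly" where
  "h_seq \<alpha> h m = smult (of_int m) h - smult (of_int (m * (m - 1)) * \<alpha>) (diff_quot \<alpha> h)"

fun \<Phi>_basis :: "complex \<Rightarrow> complex \<Rightarrow> complex \<Rightarrow> complex \<Rightarrow> complex poly \<Rightarrow>
    bms_basis \<Rightarrow> complex poly poly \<Rightarrow> complex poly poly" where
  "\<Phi>_basis l \<alpha> \<beta> \<gamma> h (BL m) f =
     smult [:l powi m:] ([:h_seq \<alpha> h m, 1:] * shift_s m f)
     - smult [:of_int m * l powi m:] (smult [:- of_int m * \<alpha>, 1:] (deriv_t (shift_s m f)))"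
| "\<Phi>_basis l \<alpha> \<beta> \<gamma> h (BM m) f =
     smult [:l powi m:] (smult [:- of_int m * \<alpha>, 1:] (shift_s m f))"
| "\<Phi>_basis l \<alpha> \<beta> \<gamma> h (BS m) f = smult [:l powi m * \<beta>:] (shift_s m f)"
| "\<Phi>_basis l \<alpha> \<beta> \<gamma> h (BI m) f =
     smult [:l powi m:] (smult ([:\<gamma>:] - smult (of_int m * \<beta>) (diff_quot \<alpha> h)) (shift_s m f))
     + smult [:of_int m * l powi m * \<beta>:] (deriv_t (shift_s m f))"

definition \<Phi>_scale :: "complex \<Rightarrow> complex poly poly \<Rightarrow> complex poly poly" where
  "\<Phi>_scale c f = smult [:c:] f"

definition \<Phi>_act :: "complex \<Rightarrow> complex \<Rightarrow> complex \<Rightarrow> complex \<Rightarrow> complex poly \<Rightarrow>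
    bms \<Rightarrow> complex poly poly \<Rightarrow> complex poly poly" where
  "\<Phi>_act l \<alpha> \<beta> \<gamma> h x f = lin_ext \<Phi>_scale (\<lambda>i. \<Phi>_basis l \<alpha> \<beta> \<gamma> h i f) x"

lemma diff_quot: "[:- \<alpha>, 1:] * diff_quot \<alpha> h = h - [:poly h \<alpha>:]"
proof -
  have "[:- \<alpha>, 1:] dvd h - [:poly h \<alpha>:]" by (simp add: poly_eq_0_iff_dvd[symmetric])
  then show ?thesis unfolding diff_quot_def by (rule dvd_mult_div_cancel)
qed

end

theory Submission
  imports Defs
begin

text \<open>Identify the module with \<open>\<complex>[s,t]\<close>, where \<open>L\<^sub>0\<close> is multiplication by \<open>s\<close> and \<open>M\<^sub>0\<close> is
  multiplication by \<open>t\<close>; this is what freeness of rank one over \<open>U(\<complex>L\<^sub>0 \<oplus> \<complex>M\<^sub>0) = \<complex>[s,t]\<close> gives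
  (\<open>free_rank_one_imp_bij_eval\<close>). The brackets of a basis element with \<open>L\<^sub>0\<close> and \<open>M\<^sub>0\<close> say how its
  action moves past \<open>s\<close> and \<open>t\<close>: it shifts \<open>s\<close> by its degree \<open>m\<close>, commutes with \<open>t\<close> in the case
  of \<open>M\<^sub>m\<close> and \<open>S\<^sub>m\<close>, and has a derivative in \<open>t\<close> as its defect in the case of \<open>L\<^sub>m\<close> and \<open>I\<^sub>m\<close>
  (\<open>operator_from_commutators\<close>). Therefore the whole module is encoded in the four families of
  polynomials \<open>M\<^sub>m\<cdot>1\<close>, \<open>L\<^sub>m\<cdot>1\<close>, \<open>S\<^sub>m\<cdot>1\<close>, \<open>I\<^sub>m\<cdot>1\<close>, and the remaining brackets are equations between them.

  First, the dependence on \<open>s\<close>. The commutator of \<open>M\<^sub>m\<close> and \<open>M\<^sub>-\<^sub>m\<close> makes the product of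
  \<open>M\<^sub>-\<^sub>m\<cdot>1\<close>, shifted, with \<open>M\<^sub>m\<cdot>1\<close> periodic in \<open>s\<close>; a periodic polynomial is constant, so
  \<open>M\<^sub>m\<cdot>1 \<in> \<complex>[t]\<close>. Then \<open>[L\<^sub>m,M\<^sub>1]\<close> forces the difference \<open>L\<^sub>m\<cdot>1 - (L\<^sub>m\<cdot>1)(s - 1, t)\<close> to be free of
  \<open>s\<close>, so \<open>L\<^sub>m\<cdot>1\<close> is linear in \<open>s\<close>; and \<open>S\<^sub>m\<cdot>1\<close>, \<open>I\<^sub>m\<cdot>1\<close> are free of \<open>s\<close> because of their
  brackets with \<open>M\<^sub>1\<close>.

  What is left are differential recurrences for polynomials in \<open>t\<close>. The brackets with
  an element of degree \<open>1\<close>, \<open>-1\<close> or \<open>-m\<close> put them into the form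
  \<open>(t + u) p' + r p = \<dots>\<close> with an integer \<open>r > 0\<close>. The operator on the left is injective on polynomials
  (\<open>euler_operator_injective\<close>: the leading coefficient in degree \<open>d\<close> is multiplied by \<open>d + r\<close>), so each recurrence
  has at most one solution, and the formulas of \<open>\<Phi>\<close> are that solution. The parameters are the data left open:
  \<open>M\<^sub>1\<cdot>1 = \<lambda> (t - \<alpha>)\<close>, \<open>h = \<lambda>\<inverse> (L\<^sub>1\<cdot>1) - s\<close>, and the scalars \<open>\<beta> = S\<^sub>0\<cdot>1\<close> and \<open>\<gamma> = I\<^sub>0\<cdot>1\<close>.\<close>

section \<open>Shifts and derivatives of polynomials in two variables\<close>

abbreviation pS :: "complex poly poly" where "pS \<equiv> [:0, 1:]"
abbreviation pT :: "complex poly poly" where "pT \<equiv> [:[:0, 1:]:]"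

lemma of_int_poly_poly: "(of_int k :: complex poly poly) = [:[:of_int k:]:]"
  by (simp add: of_int_poly)

text \<open>The form of induction needed to compare two operators on \<open>\<complex>[s,t]\<close> that move past \<open>s\<close> and \<open>t\<close>
  in the same way, and to reach all of \<open>\<complex>[s,t]\<close> from \<open>1\<close>.\<close>

lemma bipoly_induct [case_names one add scale s t]:
  assumes one: "P (1 :: complex poly poly)"
    and add: "\<And>f g. P f \<Longrightarrow> P g \<Longrightarrow> P (f + g)"
    and scale: "\<And>c f. P f \<Longrightarrow> P (\<Phi>_scale c f)"
    and s: "\<And>f. P f \<Longrightarrow> P (pS * f)"
    and t: "\<And>f. P f \<Longrightarrow> P (pT * f)"
  shows "P f"
proof -
  have c: "P [:p:]" for p
  proof (induction p)
    case 0
    show ?case using scale[OF one, of 0] by (simp add: \<Phi>_scale_def)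
  next
    case (pCons c p)
    have "[:pCons c p:] = \<Phi>_scale c 1 + pT * [:p:]"
      by (simp add: \<Phi>_scale_def)
    then show ?case using add scale one t pCons by metis
  qed
  show ?thesis
  proof (induction f)
    case 0
    show ?case using c[of 0] by simp
  next
    case (pCons p f)
    have "pCons p f = [:p:] + pS * f" by simp
    then show ?case using add c s pCons by metis
  qed
qed

lemma shift_s_simps [simp]:
  "shift_s m 0 = 0"
  "shift_s m 1 = 1"
  "shift_s m (f + g) = shift_s m f + shift_s m g"
  "shift_s m (f - g) = shift_s m f - shift_s m g"
  "shift_s m (f * g) = shift_s m f * shift_s m g"
  "shift_s m (smult p f) = smult p (shift_s m f)"
  "shift_s m [:p:] = [:p:]"
  "shift_s m [:p, q:] = [:p - of_int m * q, q:]"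
  by (simp_all add: shift_s_def pcompose_add pcompose_diff pcompose_mult pcompose_smult pcompose_pCons pcompose_1)

lemma shift_s_shift_s: "shift_s m (shift_s n f) = shift_s (m + n) f"
  by (simp add: shift_s_def pcompose_assoc[symmetric] pcompose_pCons algebra_simps)

lemma shift_s_zero [simp]: "shift_s 0 f = f"
  by (simp add: shift_s_def)

lemma poly_shift_s: "poly (shift_s m f) x = poly f (x - of_int m)"
  by (simp add: shift_s_def poly_pcompose algebra_simps)

lemma deriv_t_simps [simp]:
  "deriv_t 0 = 0"
  "deriv_t 1 = 0"
  "deriv_t (pCons p f) = pCons (pderiv p) (deriv_t f)"
  "deriv_t (f + g) = deriv_t f + deriv_t g"
  "deriv_t (f - g) = deriv_t f - deriv_t g"
  "deriv_t (smult p f) = smult (pderiv p) f + smult p (deriv_t f)"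
  by (auto intro!: poly_eqI simp: deriv_t_def coeff_map_poly pderiv_add pderiv_diff pderiv_mult
     coeff_pCons algebra_simps split: nat.splits)

lemma deriv_t_mult: "deriv_t (f * g) = deriv_t f * g + f * deriv_t g"
  by (induction f) (simp_all add: algebra_simps)

text \<open>If \<open>f(s - m) = f(s)\<close>, then \<open>f - f(0)\<close> vanishes at the infinitely many points \<open>- k m\<close>. Here the
  points are constants of the coefficient ring \<open>\<complex>[t]\<close>, a domain of characteristic zero.\<close>

lemma periodic_imp_constant:
  assumes "m \<noteq> 0" "shift_s m f = f"
  shows "f = [:coeff f 0:]"
proof -
  have per: "poly f (- of_nat k * of_int m) = poly f 0" for k
  proof (induction k)
    case (Suc k)
    have "poly f (- of_nat (Suc k) * of_int m) = poly (shift_s m f) (- of_nat k * of_int m)"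
      unfolding poly_shift_s by (rule arg_cong[where f = "poly f"]) (simp add: algebra_simps)
    then show ?case using assms Suc by simp
  qed simp
  have "inj (\<lambda>k::nat. - of_nat k * of_int m :: complex poly)"
    using assms(1) by (auto intro!: injI)
  then have "infinite (range (\<lambda>k::nat. - of_nat k * of_int m :: complex poly))"
    using finite_imageD infinite_UNIV_nat by blast
  moreover have "range (\<lambda>k::nat. - of_nat k * of_int m :: complex poly) \<subseteq> {x. poly (f - [:poly f 0:]) x = 0}"
    using per by (auto simp del: mult_minus_left)
  ultimately have "f - [:poly f 0:] = 0"
    using poly_roots_finite finite_subset by blast
  then show ?thesis by (simp add: poly_0_coeff_0)
qed

section \<open>Differential recurrences in one variable\<close>

text \<open>The operator \<open>p \<mapsto> (t + u) p' + r p\<close> multiplies the leading coefficient of a polynomial of degree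
  \<open>d\<close> by \<open>d + r\<close>, which is nonzero for \<open>r > 0\<close>. All the uniqueness in the classification comes from
  this.\<close>

lemma euler_operator_injective:
  fixes p :: "complex poly"
  assumes "r > 0" and eq: "[:u, 1:] * pderiv p + smult (of_int r) p = 0"
  shows "p = 0"
proof (rule ccontr)
  assume "p \<noteq> 0"
  let ?d = "degree p"
  have 1: "coeff (pderiv p) ?d = 0" by (simp add: coeff_pderiv coeff_eq_0)
  have 2: "coeff (pCons 0 (pderiv p)) ?d = of_nat ?d * lead_coeff p"
    by (cases ?d) (simp_all add: coeff_pderiv algebra_simps)
  have "coeff ([:u, 1:] * pderiv p + smult (of_int r) p) ?d = (of_nat ?d + of_int r) * lead_coeff p"
    using 1 2 by (simp add: algebra_simps del: mult_eq_0_iff mult_cancel_right)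
  then have "(of_nat ?d + of_int r) * lead_coeff p = 0" unfolding eq by simp
  moreover have "(of_nat ?d + of_int r :: complex) = of_int (int ?d + r)" by simp
  moreover have "int ?d + r \<noteq> 0" using assms by simp
  ultimately show False using \<open>p \<noteq> 0\<close> by (metis mult_eq_0_iff of_int_eq_0_iff leading_coeff_0_iff)
qed

lemma poly_fun_eqI: "(\<And>x. poly p x = poly q x) \<Longrightarrow> p = (q :: complex poly)"
  by (simp add: poly_eq_poly_eq_iff[symmetric] ext)

lemmas eval_simps = poly_add poly_diff poly_minus poly_mult poly_smult poly_pCons poly_0 poly_1
  pderiv_add pderiv_diff pderiv_minus pderiv_smult pderiv_mult pderiv_pCons pderiv_0

lemma euler_operator_eqI:
  fixes p q :: "complex poly"
  assumes "r > 0"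
    "[:u, 1:] * pderiv p + smult (of_int r) p = [:u, 1:] * pderiv q + smult (of_int r) q"
  shows "p = q"
proof -
  have "[:u, 1:] * pderiv (p - q) + smult (of_int r) (p - q) = 0"
    using assms(2) by (simp only: pderiv_diff smult_diff_right right_diff_distrib) (simp add: algebra_simps)
  from euler_operator_injective[OF assms(1) this] show ?thesis by simp
qed

text \<open>The constraint that \<open>[L\<^sub>m,M\<^sub>n] = (n - m) M\<^sub>m\<^sub>+\<^sub>n\<close> puts on the polynomials \<open>a m = M\<^sub>m\<cdot>1\<close> in \<open>\<complex>[t]\<close>, once the
  coefficient of \<open>s\<close> in \<open>L\<^sub>m\<cdot>1\<close> is known to be the derivative of \<open>a m\<close>.\<close>

definition M_symbols :: "(int \<Rightarrow> complex poly) \<Rightarrow> bool" where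
  "M_symbols a \<longleftrightarrow> a 0 = [:0, 1:] \<and>
     (\<forall>m n. smult (of_int n) (a n * pderiv (a m)) - smult (of_int m) (a m * pderiv (a n))
        = smult (of_int (n - m)) (a (m + n)))"

lemma M_symbols_relation:
  assumes "M_symbols a"
  shows "of_int n * (poly (a n) x * poly (pderiv (a m)) x) - of_int m * (poly (a m) x * poly (pderiv (a n)) x)
    = of_int (n - m) * poly (a (m + n)) x"
proof -
  have "smult (of_int n) (a n * pderiv (a m)) - smult (of_int m) (a m * pderiv (a n))
        = smult (of_int (n - m)) (a (m + n))"
    using assms unfolding M_symbols_def by blast
  from arg_cong[OF this, of "\<lambda>p. poly p x"] show ?thesis by (simp only: poly_diff poly_smult poly_mult)
qed

text \<open>This is the symmetry of the brackets under \<open>L\<^sub>m \<mapsto> - L\<^sub>-\<^sub>m\<close>, \<open>M\<^sub>m \<mapsto> M\<^sub>-\<^sub>m\<close>. It reduces statements about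
  negative \<open>m\<close> to positive \<open>m\<close>.\<close>

lemma M_symbols_reflect:
  assumes "M_symbols a"
  shows "M_symbols (\<lambda>m. a (- m))"
  unfolding M_symbols_def
proof (intro conjI allI)
  show "a (- 0) = [:0, 1:]" using assms by (simp add: M_symbols_def)
  fix m n
  show "smult (of_int n) (a (-n) * pderiv (a (-m))) - smult (of_int m) (a (-m) * pderiv (a (-n)))
        = smult (of_int (n - m)) (a (- (m + n)))"
  proof (rule poly_fun_eqI)
    fix x
    show "poly (smult (of_int n) (a (-n) * pderiv (a (-m))) - smult (of_int m) (a (-m) * pderiv (a (-n)))) x
        = poly (smult (of_int (n - m)) (a (- (m + n)))) x"
      using M_symbols_relation[OF assms, of "-n" x "-m"] by (simp add: algebra_simps)
  qed
qed

text \<open>The case \<open>n = - m\<close> of the constraint: \<open>a m * a (- m)\<close> is \<open>t\<^sup>2\<close> plus a constant.\<close>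

lemma M_symbols_degree_sum:
  assumes "M_symbols a" "m \<noteq> 0"
  shows "pderiv (a m * a (- m)) = [:0, 2:]" "degree (a m) + degree (a (- m)) = 2"
proof -
  show pd: "pderiv (a m * a (- m)) = [:0, 2:]"
  proof (rule poly_fun_eqI)
    fix x
    have "of_int m * poly (pderiv (a m * a (- m))) x = of_int m * poly [:0, 2:] x"
      using M_symbols_relation[OF assms(1), of "-m" x m] assms(1)
      by (simp add: M_symbols_def pderiv_mult algebra_simps)
    then show "poly (pderiv (a m * a (- m))) x = poly [:0, 2:] x" using assms(2) by simp
  qed
  then have "degree (a m * a (- m)) - 1 = 1"
    by (metis degree_pderiv degree_pCons_eq degree_pCons_0 pCons_eq_0_iff zero_neq_numeral One_nat_def)
  moreover from this have "a m \<noteq> 0" "a (-m) \<noteq> 0" by auto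
  ultimately show "degree (a m) + degree (a (- m)) = 2" by (simp add: degree_mult_eq)
qed

text \<open>If \<open>a 1\<close> were a constant, then \<open>a (- 1)\<close> would have degree \<open>2\<close> and, by the constraint for the indices \<open>1\<close>
  and \<open>-2\<close>, would be a multiple of the derivative of \<open>a (- 2)\<close>. But \<open>a (- 2)\<close> has degree at most \<open>2\<close>.\<close>

lemma M_symbols_degree_1_nonzero:
  assumes "M_symbols a"
  shows "degree (a 1) \<noteq> 0"
proof
  assume d: "degree (a 1) = 0"
  then obtain c where c: "a 1 = [:c:]" by (rule degree_eq_zeroE)
  have "degree (a (- 1)) = 2" using M_symbols_degree_sum(2)[OF assms, of 1] d by simp
  moreover have "smult c (pderiv (a (- 2))) = smult 3 (a (- 1))"
    by (rule poly_fun_eqI) (use M_symbols_relation[OF assms, of 1 _ "-2"] c in \<open>simp add: pderiv_pCons\<close>)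
  ultimately have "degree (smult c (pderiv (a (- 2)))) = 2" by simp
  then have "degree (a (- 2)) - 1 = 2" by (auto simp: degree_pderiv split: if_splits)
  then show False using M_symbols_degree_sum(2)[OF assms, of 2] by simp
qed

text \<open>With \<open>a (- 1) = \<lambda>\<inverse> (t + \<alpha>)\<close>, the constraint for the indices \<open>-1\<close> and \<open>m\<close> reads
  \<open>(t + \<alpha>) (a m)' + m a m = (m + 1) \<lambda> a (m - 1)\<close>, which determines \<open>a m\<close> from \<open>a (m - 1)\<close> for \<open>m > 0\<close>.\<close>

lemma M_symbols_nonneg:
  assumes w: "M_symbols a" and l: "l \<noteq> 0"
    and neg: "a (- 1) = smult (inverse l) [:\<alpha>, 1:]"
  shows "a (int k) = smult (l powi int k) [:- of_int (int k) * \<alpha>, 1:]"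
proof (induction k)
  case 0
  show ?case using w by (simp add: M_symbols_def)
next
  case (Suc k)
  let ?m = "int (Suc k)"
  let ?b = "smult (l powi ?m) [:- of_int ?m * \<alpha>, 1:]"
  have lk: "l powi ?m = l * l powi int k" using l by (simp add: power_int_add)
  have "[:\<alpha>, 1:] * pderiv (a ?m) + smult (of_int ?m) (a ?m) = [:\<alpha>, 1:] * pderiv ?b + smult (of_int ?m) ?b"
  proof (rule poly_fun_eqI)
    fix x
    have "inverse l * ((\<alpha> + x) * poly (pderiv (a ?m)) x + of_int ?m * poly (a ?m) x)
      = (of_int ?m + 1) * (l powi int k * (x - of_int (int k) * \<alpha>))"
      using M_symbols_relation[OF w, of "-1" x "?m"] Suc.IH neg
      by (simp add: pderiv_pCons pderiv_smult algebra_simps)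
    then have eq: "l * (inverse l * ((\<alpha> + x) * poly (pderiv (a ?m)) x + of_int ?m * poly (a ?m) x))
      = l * ((of_int ?m + 1) * (l powi int k * (x - of_int (int k) * \<alpha>)))"
      by (rule arg_cong)
    have li: "l * (inverse l * y) = y" for y using l by simp
    have k: "of_int (int k) = (of_int ?m - 1 :: complex)" by simp
    have "poly ([:\<alpha>, 1:] * pderiv (a ?m) + smult (of_int ?m) (a ?m)) x
      = l * (inverse l * ((\<alpha> + x) * poly (pderiv (a ?m)) x + of_int ?m * poly (a ?m) x))"
      unfolding li by (simp only: eval_simps) (simp add: algebra_simps)
    also have "\<dots> = poly ([:\<alpha>, 1:] * pderiv ?b + smult (of_int ?m) ?b) x"
      unfolding eq lk k by (simp only: eval_simps) (simp add: algebra_simps)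
    finally show "poly ([:\<alpha>, 1:] * pderiv (a ?m) + smult (of_int ?m) (a ?m)) x
      = poly ([:\<alpha>, 1:] * pderiv ?b + smult (of_int ?m) ?b) x" .
  qed
  from euler_operator_eqI[OF _ this] show ?case by simp
qed

text \<open>Both \<open>a 1\<close> and \<open>a (- 1)\<close> have degree one, and since their product has no linear term, the root
  of \<open>a (- 1)\<close> is the negative of the root \<open>\<alpha>\<close> of \<open>a 1\<close>. The rest is the recurrence, run upwards for
  \<open>m \<ge> 0\<close> and, after reflection, downwards.\<close>

lemma M_symbols_classification:
  assumes w: "M_symbols a"
  obtains l \<alpha> where "l \<noteq> 0" "\<And>m. a m = smult (l powi m) [:- of_int m * \<alpha>, 1:]"
proof -
  note w' = M_symbols_reflect[OF w]
  have "degree (a 1) = 1" "degree (a (- 1)) = 1"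
    using M_symbols_degree_1_nonzero[OF w] M_symbols_degree_1_nonzero[OF w']
      M_symbols_degree_sum(2)[OF w, of 1] by simp_all
  then obtain u l u' l' where a: "a 1 = [:u, l:]" "a (- 1) = [:u', l':]"
    by (metis degree1_coeffs)
  have "pderiv ([:u, l:] * [:u', l':]) = [:0, 2:]"
    using M_symbols_degree_sum(1)[OF w, of 1] a by simp
  then have eq: "l * l' = 1" "u * l' + u' * l = 0"
    by (simp_all add: pderiv_pCons algebra_simps)
  then have l: "l \<noteq> 0" "l' = inverse l" by (auto simp: inverse_unique)
  define \<alpha> where "\<alpha> = - u / l"
  have a1: "a 1 = smult l [:- \<alpha>, 1:]" "a (- 1) = smult (inverse l) [:\<alpha>, 1:]"
  proof -
    have "u' = inverse l * (u' * l)" using l by simp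
    also have "u' * l = - u * inverse l" using eq(2) l by (simp add: add_eq_0_iff2)
    finally have "u' = inverse l * \<alpha>" by (simp add: \<alpha>_def divide_inverse)
    then show "a 1 = smult l [:- \<alpha>, 1:]" "a (- 1) = smult (inverse l) [:\<alpha>, 1:]"
      using a l by (simp_all add: \<alpha>_def)
  qed
  have pos: "a (int k) = smult (l powi int k) [:- of_int (int k) * \<alpha>, 1:]" for k
    by (rule M_symbols_nonneg[OF w l(1) a1(2)])
  have neg: "a (- int k) = smult (inverse l powi int k) [:- of_int (int k) * - \<alpha>, 1:]" for k
    by (rule M_symbols_nonneg[OF w']) (use l a1 in simp_all)
  have "a m = smult (l powi m) [:- of_int m * \<alpha>, 1:]" for m
  proof (cases m rule: int_cases2)
    case (nonneg k)
    then show ?thesis using pos by simp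
  next
    case (nonpos k)
    then show ?thesis using neg[of k] by (simp add: power_int_minus power_inverse)
  qed
  then show ?thesis using that l(1) by blast
qed

lemma diff_quot_expand: "h = [:poly h \<alpha>:] + [:- \<alpha>, 1:] * diff_quot \<alpha> h"
  by (subst diff_quot) simp

text \<open>Writing \<open>h(t) = h(\<alpha>) + (t - \<alpha>) q(t)\<close> turns \<open>h\<^sub>m\<close> into \<open>m (h(\<alpha>) + (t - m \<alpha>) q(t))\<close>, which is much easier
  to compute with.\<close>

lemma h_seq_alt:
  "h_seq \<alpha> h m = smult (of_int m) ([:poly h \<alpha>:] + [:- of_int m * \<alpha>, 1:] * diff_quot \<alpha> h)"
proof (rule poly_fun_eqI)
  fix x
  have eq: "poly h x = poly h \<alpha> + (x - \<alpha>) * poly (diff_quot \<alpha> h) x"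
    using arg_cong[OF diff_quot_expand[of h \<alpha>], of "\<lambda>p. poly p x"] by (simp add: algebra_simps)
  show "poly (h_seq \<alpha> h m) x = poly (smult (of_int m) ([:poly h \<alpha>:] + [:- of_int m * \<alpha>, 1:] * diff_quot \<alpha> h)) x"
    unfolding h_seq_def by (simp only: eval_simps eq of_int_mult of_int_diff of_int_1) Groebner_Basis.algebra
qed

text \<open>The constraint that \<open>[L\<^sub>m,L\<^sub>n] = (n - m) L\<^sub>m\<^sub>+\<^sub>n\<close> puts on the polynomials \<open>k m\<close> in \<open>\<complex>[t]\<close> with
  \<open>L\<^sub>m\<cdot>1 = \<lambda>\<^sup>m (s + k m)\<close>. It is linear in \<open>k\<close>, and stated pointwise so that it is an equation of complex numbers.\<close>

definition L_symbols :: "complex \<Rightarrow> (int \<Rightarrow> complex poly) \<Rightarrow> bool" where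
  "L_symbols \<alpha> k \<longleftrightarrow> k 0 = 0 \<and> (\<forall>m n x.
     of_int n * poly (k n) x - of_int m * poly (k m) x
     - of_int m * (x - of_int m * \<alpha>) * poly (pderiv (k n)) x
     + of_int n * (x - of_int n * \<alpha>) * poly (pderiv (k m)) x
     = of_int (n - m) * poly (k (m + n)) x)"

lemma L_symbols_h_seq: "L_symbols \<alpha> (h_seq \<alpha> h)"
  unfolding L_symbols_def h_seq_alt
proof (intro conjI allI)
  fix m n :: int and x :: complex
  show "of_int n * poly (smult (of_int n) ([:poly h \<alpha>:] + [:- of_int n * \<alpha>, 1:] * diff_quot \<alpha> h)) x
    - of_int m * poly (smult (of_int m) ([:poly h \<alpha>:] + [:- of_int m * \<alpha>, 1:] * diff_quot \<alpha> h)) x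
    - of_int m * (x - of_int m * \<alpha>) *
      poly (pderiv (smult (of_int n) ([:poly h \<alpha>:] + [:- of_int n * \<alpha>, 1:] * diff_quot \<alpha> h))) x
    + of_int n * (x - of_int n * \<alpha>) *
      poly (pderiv (smult (of_int m) ([:poly h \<alpha>:] + [:- of_int m * \<alpha>, 1:] * diff_quot \<alpha> h))) x
    = of_int (n - m) *
      poly (smult (of_int (m + n)) ([:poly h \<alpha>:] + [:- of_int (m + n) * \<alpha>, 1:] * diff_quot \<alpha> h)) x"
    by (simp only: eval_simps of_int_diff of_int_add) Groebner_Basis.algebra
qed simp

lemma L_symbols_diff:
  assumes "L_symbols \<alpha> k" "L_symbols \<alpha> k'"
  shows "L_symbols \<alpha> (\<lambda>m. k m - k' m)"
  unfolding L_symbols_def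
proof (intro conjI allI)
  show "k 0 - k' 0 = 0" using assms by (simp add: L_symbols_def)
  fix m n x
  have "of_int n * poly (j n) x - of_int m * poly (j m) x
     - of_int m * (x - of_int m * \<alpha>) * poly (pderiv (j n)) x
     + of_int n * (x - of_int n * \<alpha>) * poly (pderiv (j m)) x
     = of_int (n - m) * poly (j (m + n)) x" if "L_symbols \<alpha> j" for j
    using that unfolding L_symbols_def by blast
  from this[OF assms(1)] this[OF assms(2)] show "of_int n * poly (k n - k' n) x - of_int m * poly (k m - k' m) x
     - of_int m * (x - of_int m * \<alpha>) * poly (pderiv (k n - k' n)) x
     + of_int n * (x - of_int n * \<alpha>) * poly (pderiv (k m - k' m)) x
     = of_int (n - m) * poly (k (m + n) - k' (m + n)) x"
    by (simp only: eval_simps of_int_diff) Groebner_Basis.algebra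
qed

text \<open>The constraint for the indices \<open>1\<close> and \<open>-1\<close> gives \<open>e (- 1) = 0\<close>. Then the constraints with
  one index \<open>-1\<close> (for \<open>m > 0\<close>) and with one index \<open>1\<close> (for \<open>m < 0\<close>) give \<open>(t \<plusminus> \<alpha>) (e m)' + \<bar>m\<bar> e m = 0\<close> by induction
  on \<open>\<bar>m\<bar>\<close>.\<close>

lemma L_symbols_zero:
  assumes e: "L_symbols \<alpha> e" and e1: "e 1 = 0"
  shows "e m = 0"
proof -
  have rel: "of_int n * poly (e n) x - of_int m * poly (e m) x
     - of_int m * (x - of_int m * \<alpha>) * poly (pderiv (e n)) x
     + of_int n * (x - of_int n * \<alpha>) * poly (pderiv (e m)) x
     = of_int (n - m) * poly (e (m + n)) x" for m n x
    using e unfolding L_symbols_def by blast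
  have e0: "e 0 = 0" using e by (simp add: L_symbols_def)
  have em: "e (- 1) = 0"
    by (rule euler_operator_injective[of 1 "- \<alpha>"], simp, rule poly_fun_eqI)
      (use rel[of "- 1" _ 1] e0 e1 in \<open>simp add: algebra_simps\<close>)
  have pos: "e (int k) = 0" for k
  proof (induction k)
    case (Suc k)
    show ?case
      by (rule euler_operator_injective[of "int (Suc k)" "\<alpha>"], simp, rule poly_fun_eqI)
        (use rel[of "- 1" _ "int (Suc k)"] Suc em in \<open>simp add: algebra_simps add_eq_0_iff\<close>)
  qed (simp add: e0)
  have neg: "e (- int k) = 0" for k
  proof (induction k)
    case (Suc k)
    show ?case
      by (rule euler_operator_injective[of "int (Suc k)" "- \<alpha>"], simp, rule poly_fun_eqI)
        (use rel[of 1 _ "- int (Suc k)"] Suc e1 in \<open>simp add: algebra_simps\<close>)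
  qed (simp add: e0)
  show ?thesis by (cases m rule: int_cases2) (use pos neg in auto)
qed

text \<open>By linearity: \<open>k\<close> and the solution \<open>h\<^sub>m\<close> with \<open>h = k 1\<close> have the same term at \<open>m = 1\<close>.\<close>

lemma L_symbols_classification:
  assumes "L_symbols \<alpha> k"
  shows "k m = h_seq \<alpha> (k 1) m"
proof -
  have "k m - h_seq \<alpha> (k 1) m = 0"
    by (rule L_symbols_zero[OF L_symbols_diff[OF assms L_symbols_h_seq]])
      (simp add: h_seq_def)
  then show ?thesis by simp
qed

text \<open>The hypothesis is what \<open>[L\<^sub>m,I\<^sub>n] = n I\<^sub>m\<^sub>+\<^sub>n\<close> says about the polynomials \<open>d n\<close> in \<open>\<complex>[t]\<close> with
  \<open>I\<^sub>n\<cdot>1 = \<lambda>\<^sup>n d n\<close>. For \<open>n = 0\<close> it makes \<open>d 0\<close> a constant, and for \<open>m = - n\<close> it becomes an equation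
  \<open>(t + n \<alpha>) (d n)' + d n = \<dots>\<close> with known right-hand side. With \<open>\<beta> = 0\<close> this also
  covers the \<open>S\<^sub>n\<close>.\<close>

lemma I_symbols_classification:
  assumes rel: "\<And>m n x. of_int n * poly (d n) x - of_int m * (x - of_int m * \<alpha>) * poly (pderiv (d n)) x
      - of_int n * \<beta> * poly (pderiv (h_seq \<alpha> h m)) x = of_int n * poly (d (m + n)) x"
  obtains \<gamma> where "\<And>n. d n = [:\<gamma>:] - smult (of_int n * \<beta>) (diff_quot \<alpha> h)"
proof -
  let ?q = "diff_quot \<alpha> h"
  have "[:- \<alpha>, 1:] * pderiv (d 0) = 0"
    by (rule poly_fun_eqI) (use rel[of 0 _ 1] in auto)
  then have "pderiv (d 0) = 0" by (simp only: mult_eq_0_iff) simp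
  then obtain \<gamma> where \<gamma>: "d 0 = [:\<gamma>:]" by (auto simp: pderiv_eq_0_iff elim: degree_eq_zeroE)
  have "d n = [:\<gamma>:] - smult (of_int n * \<beta>) ?q" for n
  proof (cases "n = 0")
    case False
    let ?r = "[:\<gamma>:] - smult (of_int n * \<beta>) ?q"
    show ?thesis
    proof (rule euler_operator_eqI[of 1 "of_int n * \<alpha>"], simp, rule poly_fun_eqI)
      fix x
      have "of_int n * (poly (d n) x + (x + of_int n * \<alpha>) * poly (pderiv (d n)) x
        + of_int n * \<beta> * (poly ?q x + (x + of_int n * \<alpha>) * poly (pderiv ?q) x)) = of_int n * \<gamma>"
        using rel[of n x "- n"] \<gamma> unfolding h_seq_alt
        by (simp only: eval_simps of_int_minus) (simp add: algebra_simps)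
      then have \<gamma>': "\<gamma> = poly (d n) x + (x + of_int n * \<alpha>) * poly (pderiv (d n)) x
        + of_int n * \<beta> * (poly ?q x + (x + of_int n * \<alpha>) * poly (pderiv ?q) x)"
        using False by simp
      show "poly ([:of_int n * \<alpha>, 1:] * pderiv (d n) + smult (of_int 1) (d n)) x
        = poly ([:of_int n * \<alpha>, 1:] * pderiv ?r + smult (of_int 1) ?r) x"
        unfolding \<gamma>' by (simp only: eval_simps of_int_1) Groebner_Basis.algebra
    qed
  qed (simp add: \<gamma>)
  then show ?thesis using that by blast
qed

section \<open>Module structures on \<open>\<complex>[s,t]\<close> extending multiplication by \<open>s\<close> and \<open>t\<close>\<close>

lemma first_difference_constant_imp_linear:
  assumes "degree (f - shift_s 1 f) = 0"
  obtains k g where "f = [:k, g:]"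
proof -
  obtain g where g: "f - shift_s 1 f = [:g:]" using assms by (rule degree_eq_zeroE)
  have "shift_s 1 (f - [:0, g:]) = f - [:0, g:]"
  proof -
    have "shift_s 1 f = f - [:g:]" using g by (simp add: algebra_simps)
    then show ?thesis by simp
  qed
  then have "f - [:0, g:] = [:coeff (f - [:0, g:]) 0:]" by (intro periodic_imp_constant[of 1]) simp
  then have "f = [:coeff (f - [:0, g:]) 0:] + [:0, g:]" by (metis diff_add_cancel)
  then show ?thesis using that by simp
qed

text \<open>An operator on \<open>\<complex>[s,t]\<close> is determined by its value at \<open>1\<close> and its commutators with \<open>s\<close> and \<open>t\<close>.
  For \<open>M\<^sub>m\<close> and \<open>S\<^sub>m\<close> the commutator with \<open>t\<close> vanishes; for \<open>L\<^sub>m\<close> it is \<open>- m M\<^sub>m\<close> and for \<open>I\<^sub>m\<close> it is \<open>m S\<^sub>m\<close>,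
  which is where the derivative in \<open>t\<close> in the formulas of \<open>\<Phi>\<close> comes from.\<close>

lemma operator_from_commutators:
  fixes T :: "complex poly poly \<Rightarrow> complex poly poly"
  assumes add: "\<And>f g. T (f + g) = T f + T g"
    and scale: "\<And>c f. T (\<Phi>_scale c f) = \<Phi>_scale c (T f)"
    and s: "\<And>f. T (pS * f) - pS * T f = of_int (- m) * T f"
    and t: "\<And>f. T (pT * f) - pT * T f = of_int e * (shift_s m f * u)"
  shows "T f = shift_s m f * T 1 + of_int e * (deriv_t (shift_s m f) * u)"
proof (induction f rule: bipoly_induct)
  case one
  show ?case by simp
next
  case (add f g)
  then show ?case by (simp add: assms(1) algebra_simps)
next
  case (scale c f)
  then show ?case by (simp add: assms(2)) (simp add: \<Phi>_scale_def algebra_simps smult_add_right)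
next
  case (s f)
  have e1: "T (pS * f) = (pS - of_int m) * T f" using assms(3)[of f] unfolding of_int_minus by Groebner_Basis.algebra
  have e2: "shift_s m (pS * f) = (pS - of_int m) * shift_s m f"
    by (simp only: shift_s_simps) (simp add: of_int_poly)
  have e3: "deriv_t ((pS - of_int m) * shift_s m f) = (pS - of_int m) * deriv_t (shift_s m f)"
    by (simp only: deriv_t_mult) (simp add: of_int_poly)
  show ?case unfolding e1 e2 e3 s by Groebner_Basis.algebra
next
  case (t f)
  have e1: "T (pT * f) = pT * T f + of_int e * (shift_s m f * u)"
    using assms(4)[of f] by Groebner_Basis.algebra
  have e2: "shift_s m (pT * f) = pT * shift_s m f"
    by (simp only: shift_s_simps)
  have e3: "deriv_t (pT * shift_s m f) = shift_s m f + pT * deriv_t (shift_s m f)"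
    by (simp only: deriv_t_mult) (simp add: pderiv_pCons one_pCons[symmetric])
  show ?case unfolding e1 e2 e3 t by Groebner_Basis.algebra
qed

locale bms_module_on_polys = lie_module fs_scale bms_bracket \<Phi>_scale A
  for A :: "bms \<Rightarrow> complex poly poly \<Rightarrow> complex poly poly" +
  assumes L0: "A (bvec (BL 0)) f = pS * f"
    and M0: "A (bvec (BM 0)) f = pT * f"
begin

abbreviation "L m \<equiv> A (bvec (BL m))"
abbreviation "M m \<equiv> A (bvec (BM m))"
abbreviation "S m \<equiv> A (bvec (BS m))"
abbreviation "I m \<equiv> A (bvec (BI m))"

lemma act_single: "A (Poly_Mapping.single i c) f = [:[:c:]:] * A (bvec i) f"
  using act_scale_left[of c "bvec i" f] by (simp add: \<Phi>_scale_def)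

lemma act_zero [simp]: "A 0 f = 0"
  using act_add_left[of 0 0 f] by simp

lemma commutator: "A (bvec i) (A (bvec j) f) - A (bvec j) (A (bvec i) f) = A (basis_bracket i j) f"
  using act_bracket[of "bvec i" "bvec j" f] scale_one
  by (simp add: bms_bracket_single)

text \<open>Unlike \<open>act_single\<close>, this is usable as a rewrite rule: the left-hand side does not match
  \<open>bvec i\<close>, which is a \<open>single\<close> itself.\<close>

lemma act_single_of_int: "A (Poly_Mapping.single i (of_int k)) f = of_int k * A (bvec i) f"
  by (subst act_single) (simp only: of_int_poly_poly)

lemma s_commutator:
  assumes "basis_bracket i (BL 0) = Poly_Mapping.single i (of_int (- m))"
  shows "A (bvec i) (pS * f) - pS * A (bvec i) f = of_int (- m) * A (bvec i) f"
  using commutator[of i "BL 0" f] by (simp only: L0 assms act_single_of_int)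

lemma s_commutators:
  "L m (pS * f) - pS * L m f = of_int (- m) * L m f"
  "M m (pS * f) - pS * M m f = of_int (- m) * M m f"
  "S m (pS * f) - pS * S m f = of_int (- m) * S m f"
  "I m (pS * f) - pS * I m f = of_int (- m) * I m f"
  by (rule s_commutator, simp)+

lemma t_commutator:
  assumes "basis_bracket i (BM 0) = Poly_Mapping.single j (of_int m)"
  shows "A (bvec i) (pT * f) - pT * A (bvec i) f = of_int m * A (bvec j) f"
  using commutator[of i "BM 0" f] by (simp only: M0 assms act_single_of_int)

lemma t_commutators:
  "L m (pT * f) - pT * L m f = of_int (- m) * M m f"
  "M m (pT * f) - pT * M m f = 0"
  "S m (pT * f) - pT * S m f = 0"
  "I m (pT * f) - pT * I m f = of_int m * S m f"
proof -
  show "L m (pT * f) - pT * L m f = of_int (- m) * M m f"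
    by (rule t_commutator) simp
  show "M m (pT * f) - pT * M m f = 0"
    using t_commutator[of "BM m" "BM m" 0 f] by simp
  show "S m (pT * f) - pT * S m f = 0"
    using t_commutator[of "BS m" "BS m" 0 f] by simp
  show "I m (pT * f) - pT * I m f = of_int m * S m f"
    by (rule t_commutator) simp
qed

lemma M_formula: "M m f = shift_s m f * M m 1"
proof -
  have "M m f = shift_s m f * M m 1 + of_int 0 * (deriv_t (shift_s m f) * 0)"
    by (rule operator_from_commutators[OF act_add_right act_scale_right s_commutators(2)])
      (simp only: t_commutators of_int_0 mult_zero_left)
  then show ?thesis by simp
qed

lemma S_formula: "S m f = shift_s m f * S m 1"
proof -
  have "S m f = shift_s m f * S m 1 + of_int 0 * (deriv_t (shift_s m f) * 0)"
    by (rule operator_from_commutators[OF act_add_right act_scale_right s_commutators(3)])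
      (simp only: t_commutators of_int_0 mult_zero_left)
  then show ?thesis by simp
qed

lemma L_formula: "L m f = shift_s m f * L m 1 - of_int m * (deriv_t (shift_s m f) * M m 1)"
proof -
  have "L m f = shift_s m f * L m 1 + of_int (- m) * (deriv_t (shift_s m f) * M m 1)"
    by (rule operator_from_commutators[OF act_add_right act_scale_right s_commutators(1)])
      (simp only: t_commutators of_int_minus M_formula[symmetric])
  then show ?thesis by simp
qed

lemma I_formula: "I m f = shift_s m f * I m 1 + of_int m * (deriv_t (shift_s m f) * S m 1)"
  by (rule operator_from_commutators[where T = "I m", OF act_add_right act_scale_right s_commutators(4)])
    (simp only: t_commutators S_formula[symmetric])

text \<open>The brackets evaluated at \<open>1\<close>, with the inner action expressed by the formulas above.\<close>

lemma MM_relation: "shift_s m (M n 1) * M m 1 = shift_s n (M m 1) * M n 1"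
  using commutator[of "BM m" "BM n" 1] M_formula[of m "M n 1"] M_formula[of n "M m 1"] by simp

lemma LM_relation:
  "shift_s m (M n 1) * L m 1 - of_int m * (deriv_t (shift_s m (M n 1)) * M m 1) - shift_s n (L m 1) * M n 1
    = of_int (n - m) * M (m + n) 1"
  using commutator[of "BL m" "BM n" 1]
  by (simp only: basis_bracket.simps act_single_of_int L_formula[of m "M n 1"] M_formula[of n "L m 1"])

lemma LL_relation:
  "shift_s m (L n 1) * L m 1 - of_int m * (deriv_t (shift_s m (L n 1)) * M m 1)
    - (shift_s n (L m 1) * L n 1 - of_int n * (deriv_t (shift_s n (L m 1)) * M n 1))
    = of_int (n - m) * L (m + n) 1"
  using commutator[of "BL m" "BL n" 1]
  by (simp only: basis_bracket.simps act_single_of_int L_formula[of m "L n 1"] L_formula[of n "L m 1"])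

lemma MS_relation: "shift_s m (S n 1) * M m 1 = shift_s n (M m 1) * S n 1"
  using commutator[of "BM m" "BS n" 1] M_formula[of m "S n 1"] S_formula[of n "M m 1"] by simp

lemma LS_relation:
  "shift_s m (S n 1) * L m 1 - of_int m * (deriv_t (shift_s m (S n 1)) * M m 1) - shift_s n (L m 1) * S n 1
    = of_int n * S (m + n) 1"
  using commutator[of "BL m" "BS n" 1]
  by (simp only: basis_bracket.simps act_single_of_int L_formula[of m "S n 1"] S_formula[of n "L m 1"])

lemma MI_relation:
  "shift_s m (I n 1) * M m 1 - (shift_s n (M m 1) * I n 1 + of_int n * (deriv_t (shift_s n (M m 1)) * S n 1))
    = of_int (- n) * S (m + n) 1"
  using commutator[of "BM m" "BI n" 1]
  by (simp only: basis_bracket.simps act_single_of_int M_formula[of m "I n 1"] I_formula[of n "M m 1"])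

lemma LI_relation:
  "shift_s m (I n 1) * L m 1 - of_int m * (deriv_t (shift_s m (I n 1)) * M m 1)
    - (shift_s n (L m 1) * I n 1 + of_int n * (deriv_t (shift_s n (L m 1)) * S n 1))
    = of_int n * I (m + n) 1"
  using commutator[of "BL m" "BI n" 1]
  by (simp only: basis_bracket.simps act_single_of_int L_formula[of m "I n 1"] I_formula[of n "L m 1"])

text \<open>Every term of \<open>[L\<^sub>-\<^sub>m,M\<^sub>m]\<cdot>1\<close> has \<open>M\<^sub>m\<cdot>1\<close>, a shift or a derivative of it as a factor, but this bracket
  is \<open>2 m M\<^sub>0\<cdot>1 = 2 m t\<close>.\<close>

lemma M_nonzero: "M m 1 \<noteq> 0"
proof
  assume "M m 1 = 0"
  moreover from this have "m \<noteq> 0" using M0[of 1] by auto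
  moreover from calculation have "of_int (m - - m) * M 0 1 = 0"
    using LM_relation[of "- m" m] by simp
  ultimately show False using M0[of 1] by simp
qed

text \<open>Let \<open>F\<close> be \<open>M\<^sub>m M\<^sub>-\<^sub>m\<cdot>1 = (M\<^sub>-\<^sub>m\<cdot>1)(s - m) (M\<^sub>m\<cdot>1)(s)\<close>. Shifting \<open>F\<close> by \<open>- m\<close> gives
  \<open>M\<^sub>-\<^sub>m M\<^sub>m\<cdot>1\<close>, which is \<open>F\<close> again. So \<open>F\<close> has degree \<open>0\<close> in \<open>s\<close>, and so do its nonzero factors.\<close>

lemma M_constant: "M m 1 = [:coeff (M m 1) 0:]"
proof (cases "m = 0")
  case True
  then show ?thesis by (simp add: M0)
next
  case False
  define F where "F = shift_s m (M (- m) 1) * M m 1"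
  have "shift_s (- m) F = M (- m) 1 * shift_s (- m) (M m 1)"
    by (simp add: F_def shift_s_shift_s)
  also have "\<dots> = F" using MM_relation[of m "- m"] by (simp add: F_def mult.commute)
  finally have "F = [:coeff F 0:]" using False by (intro periodic_imp_constant[of "- m"]) simp_all
  then have "degree F = 0" by (metis degree_pCons_0)
  moreover have "shift_s m (M (- m) 1) \<noteq> 0"
    using M_nonzero[of "- m"] by (metis add.right_inverse shift_s_shift_s shift_s_simps(1) shift_s_zero add.commute)
  ultimately have "degree (M m 1) = 0"
    using M_nonzero[of m] by (simp add: F_def degree_mult_eq)
  then show ?thesis by (metis degree_eq_zeroE coeff_pCons_0)
qed

text \<open>As \<open>M\<^sub>n\<cdot>1\<close> does not involve \<open>s\<close>, the relation of \<open>L\<^sub>m\<close> and \<open>M\<^sub>1\<close> expresses \<open>M\<^sub>1\<cdot>1\<close> times the first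
  difference of \<open>L\<^sub>m\<cdot>1\<close> by polynomials in \<open>t\<close>.\<close>

lemma L_linear: "L m 1 = [:coeff (L m 1) 0, coeff (L m 1) 1:]"
proof -
  obtain p where p: "\<And>n. M n 1 = [:p n:]" by (rule that[OF M_constant])
  let ?D = "L m 1 - shift_s 1 (L m 1)"
  have "[:p 1:] * ?D = of_int (1 - m) * [:p (m + 1):] + of_int m * [:pderiv (p 1) * p m:]"
    using LM_relation[of m 1] by (simp add: p of_int_poly algebra_simps)
  then have "degree ([:p 1:] * ?D) = 0" by (simp add: of_int_poly)
  moreover have "p 1 \<noteq> 0" using M_nonzero[of 1] p by simp
  ultimately have "degree ?D = 0" by (cases "?D = 0") (simp_all add: degree_mult_eq)
  then obtain k g where "L m 1 = [:k, g:]" by (rule first_difference_constant_imp_linear)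
  then show ?thesis by simp
qed

lemma LM_action_on_1:
  obtains l \<alpha> k where "l \<noteq> 0" "\<And>m. M m 1 = [:smult (l powi m) [:- of_int m * \<alpha>, 1:]:]"
    "\<And>m. L m 1 = [:smult (l powi m) (k m), [:l powi m:]:]"
proof -
  obtain p where p: "\<And>n. M n 1 = [:p n:]" by (rule that[OF M_constant])
  obtain k g where kg: "\<And>n. L n 1 = [:k n, g n:]" by (rule that[OF L_linear])
  have p0: "p 0 = [:0, 1:]" using p[of 0] M0[of 1] by simp
  have rel: "smult (of_int n) (p n * g m) - smult (of_int m) (p m * pderiv (p n))
    = smult (of_int (n - m)) (p (m + n))" for m n
    using LM_relation[of m n] by (simp add: p kg of_int_poly algebra_simps)
  \<comment> \<open>For \<open>m = n \<noteq> 0\<close> the right-hand side of \<open>rel\<close> vanishes and \<open>p n\<close> can be cancelled.\<close>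
  have g: "g n = pderiv (p n)" for n
  proof (cases "n = 0")
    case True
    then show ?thesis using kg[of 0] L0[of 1] p0 by (simp add: pderiv_pCons)
  next
    case False
    have "smult (of_int n) (p n * (g n - pderiv (p n))) = 0"
      using rel[of n n] by (simp add: right_diff_distrib smult_diff_right)
    moreover have "p n \<noteq> 0" using M_nonzero[of n] p by simp
    ultimately show ?thesis using False by simp
  qed
  have "M_symbols p"
    unfolding M_symbols_def using p0 rel[unfolded g] by blast
  then obtain l \<alpha> where l: "l \<noteq> 0" and pl: "\<And>m. p m = smult (l powi m) [:- of_int m * \<alpha>, 1:]"
    using M_symbols_classification by blast
  have "L m 1 = [:smult (l powi m) (smult (inverse (l powi m)) (k m)), [:l powi m:]:]" for m
    using l by (simp add: kg g pl pderiv_smult pderiv_pCons)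
  then show ?thesis using that[of l \<alpha> "\<lambda>m. smult (inverse (l powi m)) (k m)"] l p pl by simp
qed

lemma constant_in_s_if_commutes_with_M:
  assumes "\<And>m. M m 1 * shift_s m f = M m 1 * f"
  shows "f = [:coeff f 0:]"
proof (rule periodic_imp_constant)
  show "shift_s 1 f = f" using assms[of 1] M_nonzero[of 1] by simp
qed simp

text \<open>Comparing the coefficients of \<open>s\<^sup>0\<close> in the brackets of \<open>L\<^sub>m\<close> with \<open>L\<^sub>n\<close>, \<open>S\<^sub>n\<close> and \<open>I\<^sub>n\<close> and cancelling
  \<open>\<lambda>\<^sup>m\<^sup>+\<^sup>n\<close> leaves exactly the recurrences solved above. The \<open>S\<^sub>n\<close> have to come before the \<open>I\<^sub>n\<close>, since \<open>\<beta>\<close> enters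
  the recurrence of the latter.\<close>

lemma LSI_action_on_1:
  assumes "l \<noteq> 0" and M: "\<And>m. M m 1 = [:smult (l powi m) [:- of_int m * \<alpha>, 1:]:]"
    and L: "\<And>m. L m 1 = [:smult (l powi m) (k m), [:l powi m:]:]"
  obtains \<beta> \<gamma> h where "\<And>m. k m = h_seq \<alpha> h m" "\<And>m. S m 1 = [:[:l powi m * \<beta>:]:]"
    "\<And>m. I m 1 = [:smult (l powi m) ([:\<gamma>:] - smult (of_int m * \<beta>) (diff_quot \<alpha> h)):]"
proof -
  note la = power_int_add[OF disjI1[OF \<open>l \<noteq> 0\<close>]]
  have l: "l powi m \<noteq> 0" for m using \<open>l \<noteq> 0\<close> by simp
  have "L_symbols \<alpha> k"
    unfolding L_symbols_def
  proof (intro conjI allI)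
    show "k 0 = 0" using L[of 0] L0[of 1] by simp
    fix m n :: int and x :: complex
    let ?lhs = "of_int n * poly (k n) x - of_int m * poly (k m) x
     - of_int m * (x - of_int m * \<alpha>) * poly (pderiv (k n)) x
     + of_int n * (x - of_int n * \<alpha>) * poly (pderiv (k m)) x"
    let ?rhs = "of_int (n - m) * poly (k (m + n)) x"
    have "(l powi m * l powi n) * ?lhs = (l powi m * l powi n) * ?rhs"
      using arg_cong[OF LL_relation[of m n], of "\<lambda>f. poly (coeff f 0) x"]
      by (simp add: M L of_int_poly la pderiv_smult pderiv_diff pderiv_pCons algebra_simps)
    then show "?lhs = ?rhs" using \<open>l \<noteq> 0\<close> by simp
  qed
  then obtain h where k: "k m = h_seq \<alpha> h m" for m using L_symbols_classification by blast

  have "S n 1 = [:coeff (S n 1) 0:]" for n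
    by (rule constant_in_s_if_commutes_with_M) (use MS_relation[of _ n] M in \<open>simp add: mult.commute\<close>)
  then obtain c where c: "S n 1 = [:smult (l powi n) (c n):]" for n
  proof -
    assume "\<And>n. S n 1 = [:coeff (S n 1) 0:]"
    then have "S n 1 = [:smult (l powi n) (smult (inverse (l powi n)) (coeff (S n 1) 0)):]" for n
      using l by simp
    then show ?thesis by (rule that)
  qed
  \<comment> \<open>The recurrence of the \<open>S\<^sub>n\<close> is that of the \<open>I\<^sub>n\<close> with \<open>\<beta> = 0\<close> and \<open>h = 0\<close>; its constant \<open>\<gamma>\<close> is the \<open>\<beta>\<close> sought here.\<close>
  obtain \<beta> where "\<And>n. c n = [:\<beta>:] - smult (of_int n * 0) (diff_quot \<alpha> 0)"
  proof (rule I_symbols_classification[of c \<alpha> 0 0])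
    fix m n :: int and x :: complex
    let ?lhs = "of_int n * poly (c n) x - of_int m * (x - of_int m * \<alpha>) * poly (pderiv (c n)) x
      - of_int n * 0 * poly (pderiv (h_seq \<alpha> 0 m)) x"
    let ?rhs = "of_int n * poly (c (m + n)) x"
    have "(l powi m * l powi n) * ?lhs = (l powi m * l powi n) * ?rhs"
      using arg_cong[OF LS_relation[of m n], of "\<lambda>f. poly (coeff f 0) x"]
      by (simp add: M L c of_int_poly la pderiv_smult pderiv_diff pderiv_pCons algebra_simps)
    then show "?lhs = ?rhs" using \<open>l \<noteq> 0\<close> by simp
  qed blast
  then have S: "S m 1 = [:[:l powi m * \<beta>:]:]" for m by (simp add: c)

  have "I n 1 = [:coeff (I n 1) 0:]" for n
    by (rule constant_in_s_if_commutes_with_M)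
      (use MI_relation[of _ n] in \<open>simp add: M S la of_int_poly pderiv_smult pderiv_pCons algebra_simps\<close>)
  then obtain d where d: "I n 1 = [:smult (l powi n) (d n):]" for n
  proof -
    assume "\<And>n. I n 1 = [:coeff (I n 1) 0:]"
    then have "I n 1 = [:smult (l powi n) (smult (inverse (l powi n)) (coeff (I n 1) 0)):]" for n
      using l by simp
    then show ?thesis by (rule that)
  qed
  obtain \<gamma> where "\<And>n. d n = [:\<gamma>:] - smult (of_int n * \<beta>) (diff_quot \<alpha> h)"
  proof (rule I_symbols_classification[of d \<alpha> \<beta> h])
    fix m n :: int and x :: complex
    let ?lhs = "of_int n * poly (d n) x - of_int m * (x - of_int m * \<alpha>) * poly (pderiv (d n)) x
      - of_int n * \<beta> * poly (pderiv (h_seq \<alpha> h m)) x"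
    let ?rhs = "of_int n * poly (d (m + n)) x"
    have "(l powi m * l powi n) * ?lhs = (l powi m * l powi n) * ?rhs"
      using arg_cong[OF LI_relation[of m n], of "\<lambda>f. poly (coeff f 0) x"]
      by (simp add: M L S d of_int_poly la pderiv_smult pderiv_diff pderiv_pCons algebra_simps flip: k)
    then show "?lhs = ?rhs" using \<open>l \<noteq> 0\<close> by simp
  qed blast
  then show ?thesis using that[of h \<beta> \<gamma>] k S d by simp
qed

lemma equals_\<Phi>: "\<exists>l \<alpha> \<beta> \<gamma> h. l \<noteq> 0 \<and> (\<forall>x f. A x f = \<Phi>_act l \<alpha> \<beta> \<gamma> h x f)"
proof -
  obtain l \<alpha> k where l: "l \<noteq> 0" and M: "\<And>m. M m 1 = [:smult (l powi m) [:- of_int m * \<alpha>, 1:]:]"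
    and L: "\<And>m. L m 1 = [:smult (l powi m) (k m), [:l powi m:]:]"
    by (rule LM_action_on_1) blast
  obtain \<beta> \<gamma> h where k: "\<And>m. k m = h_seq \<alpha> h m" and S: "\<And>m. S m 1 = [:[:l powi m * \<beta>:]:]"
    and I: "\<And>m. I m 1 = [:smult (l powi m) ([:\<gamma>:] - smult (of_int m * \<beta>) (diff_quot \<alpha> h)):]"
    by (rule LSI_action_on_1[OF l M L]) blast
  have basis: "A (bvec i) f = \<Phi>_basis l \<alpha> \<beta> \<gamma> h i f" for i f
  proof (cases i)
    case (BL m)
    have "L m 1 = smult [:l powi m:] [:h_seq \<alpha> h m, 1:]" by (simp add: L k)
    moreover have "M m 1 = smult [:l powi m:] [:[:- of_int m * \<alpha>, 1:]:]" by (simp add: M)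
    ultimately show ?thesis
      unfolding BL L_formula[of m f] by (simp add: of_int_poly algebra_simps smult_diff_right smult_add_right)
  next
    case (BM m)
    show ?thesis unfolding BM M_formula[of m f] by (simp add: M algebra_simps)
  next
    case (BS m)
    show ?thesis unfolding BS S_formula[of m f] by (simp add: S)
  next
    case (BI m)
    show ?thesis unfolding BI I_formula[of m f] by (simp add: S I of_int_poly algebra_simps smult_diff_right)
  qed
  have "A x f = \<Phi>_act l \<alpha> \<beta> \<gamma> h x f" for x f
  proof (induction x rule: fs_induct)
    case (single i c)
    show ?case
      using act_scale_left[of c "bvec i" f]
      by (simp add: \<Phi>_act_def basis lin_ext_single[OF V.vector_space_axioms])
  qed (simp_all add: \<Phi>_act_def act_add_left lin_ext_add[OF V.vector_space_axioms])
  then show ?thesis using l by blast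
qed

end

section \<open>The enveloping algebra of \<open>\<complex>L\<^sub>0 \<oplus> \<complex>M\<^sub>0\<close>\<close>

lemma vector_space_\<Phi>_scale: "vector_space \<Phi>_scale"
  by unfold_locales (simp_all add: \<Phi>_scale_def smult_add_right mult.commute flip: one_pCons smult_add_left)

text \<open>The linear map with \<open>L\<^sub>0 \<mapsto> s\<close> and \<open>M\<^sub>0 \<mapsto> t\<close>. Its extension \<open>free_algebra_eval\<close> to the free algebra has
  values in a commutative ring, and will be seen to induce \<open>U(\<complex>L\<^sub>0 \<oplus> \<complex>M\<^sub>0) \<rightarrow> \<complex>[s,t]\<close>.\<close>

definition L0_M0_symbol :: "bms \<Rightarrow> complex poly poly" where
  "L0_M0_symbol x = \<Phi>_scale (Poly_Mapping.lookup x (BL 0)) pS + \<Phi>_scale (Poly_Mapping.lookup x (BM 0)) pT"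

definition free_algebra_eval :: "(bms word \<Rightarrow>\<^sub>0 complex) \<Rightarrow> complex poly poly" where
  "free_algebra_eval p = lin_ext \<Phi>_scale (\<lambda>w. prod_list (map L0_M0_symbol (letters w))) p"

lemma L0_M0_span_expand:
  assumes "x \<in> L0_M0_span"
  shows "x = fs_scale (Poly_Mapping.lookup x (BL 0)) (bvec (BL 0)) + fs_scale (Poly_Mapping.lookup x (BM 0)) (bvec (BM 0))"
proof -
  obtain a b where "x - fs_scale a (bvec (BL 0)) - fs_scale b (bvec (BM 0)) = 0"
    using assms unfolding L0_M0_span_def bms.span_breakdown_eq bms.span_empty by blast
  then have x: "x = fs_scale a (bvec (BL 0)) + fs_scale b (bvec (BM 0))" by (simp add: algebra_simps)
  show ?thesis by (subst (1) x) (simp add: x lookup_add lookup_single)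
qed

lemma L0_M0_span_bracket:
  assumes "x \<in> L0_M0_span" "y \<in> L0_M0_span"
  shows "bms_bracket x y = 0"
  by (subst L0_M0_span_expand[OF assms(1)], subst L0_M0_span_expand[OF assms(2)])
    (simp add: bms_bracket_add_left bms_bracket_add_right bms_bracket_single)

lemma subspace_L0_M0_span: "bms.subspace L0_M0_span"
  by (simp add: L0_M0_span_def)

lemma in_L0_M0_span [simp]: "bvec (BL 0) \<in> L0_M0_span" "bvec (BM 0) \<in> L0_M0_span" "0 \<in> L0_M0_span"
  by (auto simp: L0_M0_span_def intro: bms.span_base bms.span_zero)

lemma L0_M0_symbol_simps:
  "L0_M0_symbol (x + y) = L0_M0_symbol x + L0_M0_symbol y"
  "L0_M0_symbol (fs_scale c x) = \<Phi>_scale c (L0_M0_symbol x)"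
  "L0_M0_symbol 0 = 0"
  "L0_M0_symbol (bvec (BL 0)) = pS"
  "L0_M0_symbol (bvec (BM 0)) = pT"
  by (simp_all add: L0_M0_symbol_def \<Phi>_scale_def lookup_add lookup_single)

lemma free_algebra_eval_add: "free_algebra_eval (p + q) = free_algebra_eval p + free_algebra_eval q"
  by (simp add: free_algebra_eval_def lin_ext_add[OF vector_space_\<Phi>_scale])

lemma free_algebra_eval_diff: "free_algebra_eval (p - q) = free_algebra_eval p - free_algebra_eval q"
  by (simp add: free_algebra_eval_def lin_ext_diff[OF vector_space_\<Phi>_scale])

lemma free_algebra_eval_scale: "free_algebra_eval (fs_scale c p) = \<Phi>_scale c (free_algebra_eval p)"
  by (simp add: free_algebra_eval_def lin_ext_scale[OF vector_space_\<Phi>_scale])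

lemma free_algebra_eval_single:
  "free_algebra_eval (Poly_Mapping.single w c) = \<Phi>_scale c (prod_list (map L0_M0_symbol (letters w)))"
  by (simp add: free_algebra_eval_def lin_ext_single[OF vector_space_\<Phi>_scale])

lemma free_algebra_eval_zero [simp]: "free_algebra_eval 0 = 0"
  by (simp add: free_algebra_eval_def)

lemma free_algebra_eval_mult: "free_algebra_eval (p * q) = free_algebra_eval p * free_algebra_eval q"
proof (induction p rule: fs_induct)
  case (single w c)
  show ?case
  proof (induction q rule: fs_induct)
    case (single u d)
    show ?case
      by (simp add: mult_single free_algebra_eval_single plus_word_def \<Phi>_scale_def mult.commute)
  qed (simp_all add: distrib_left free_algebra_eval_add)
qed (simp_all add: distrib_right free_algebra_eval_add)

lemma free_algebra_carrier_iff:
  "p \<in> carrier (free_algebra H) \<longleftrightarrow> (\<forall>w\<in>Poly_Mapping.keys p. set (letters w) \<subseteq> H)"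
  by (simp add: free_algebra_def)

lemma single_in_free_algebra: "set xs \<subseteq> H \<Longrightarrow> Poly_Mapping.single (Word xs) c \<in> carrier (free_algebra H)"
  by (simp add: free_algebra_carrier_iff)

lemma free_algebra_diff_closed:
  assumes "p \<in> carrier (free_algebra H)" "q \<in> carrier (free_algebra H)"
  shows "p - q \<in> carrier (free_algebra H)"
proof -
  have "Poly_Mapping.keys (p - q) \<subseteq> Poly_Mapping.keys p \<union> Poly_Mapping.keys q"
    by (auto simp: in_keys_iff lookup_minus)
  then show ?thesis using assms by (auto simp: free_algebra_carrier_iff)
qed

text \<open>The kernel of the evaluation is an ideal and contains the relations, because \<open>\<complex>[s,t]\<close> and
  the subalgebra \<open>\<complex>L\<^sub>0 \<oplus> \<complex>M\<^sub>0\<close> are commutative. This is the half of \<open>U(\<complex>L\<^sub>0 \<oplus> \<complex>M\<^sub>0) \<cong> \<complex>[s,t]\<close>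
  that bounds the enveloping algebra from below.\<close>

lemma free_algebra_eval_ideal:
  assumes "p \<in> Idl\<^bsub>free_algebra L0_M0_span\<^esub> (bms.enveloping_relations L0_M0_span)"
  shows "free_algebra_eval p = 0"
proof -
  let ?F = "free_algebra L0_M0_span"
  interpret F: ring ?F by (rule ring_free_algebra)
  let ?K = "{p \<in> carrier ?F. free_algebra_eval p = 0}"
  have ops: "p \<oplus>\<^bsub>?F\<^esub> q = p + q" "p \<otimes>\<^bsub>?F\<^esub> q = p * q" "\<zero>\<^bsub>?F\<^esub> = 0" for p q
    by (simp_all add: free_algebra_def)
  have "ideal ?K ?F"
  proof (rule idealI)
    show "subgroup ?K (add_monoid ?F)"
    proof (rule F.add.subgroupI)
      show "\<ominus>\<^bsub>?F\<^esub> a \<in> ?K" if "a \<in> ?K" for a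
      proof -
        have "\<ominus>\<^bsub>?F\<^esub> a \<oplus>\<^bsub>?F\<^esub> a = \<zero>\<^bsub>?F\<^esub>"
          using that by (simp add: F.l_neg)
        then have "free_algebra_eval (\<ominus>\<^bsub>?F\<^esub> a + a) = 0" by (simp only: ops free_algebra_eval_zero)
        then show ?thesis using that by (simp add: ops free_algebra_eval_add)
      qed
      show "a \<oplus>\<^bsub>?F\<^esub> b \<in> ?K" if "a \<in> ?K" "b \<in> ?K" for a b
        using that F.a_closed[of a b] by (simp add: ops free_algebra_eval_add)
      show "?K \<noteq> {}" using F.zero_closed unfolding ops by auto
    qed auto
    show "x \<otimes>\<^bsub>?F\<^esub> a \<in> ?K" "a \<otimes>\<^bsub>?F\<^esub> x \<in> ?K" if "a \<in> ?K" "x \<in> carrier ?F" for a x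
      using that F.m_closed[of x a] F.m_closed[of a x] by (simp_all add: ops free_algebra_eval_mult)
  qed (rule ring_free_algebra)
  moreover have "bms.enveloping_relations L0_M0_span \<subseteq> ?K"
    using bms.subspace_add[OF subspace_L0_M0_span] bms.subspace_scale[OF subspace_L0_M0_span]
    by (auto simp: bms.enveloping_relations_def L0_M0_span_bracket free_algebra_eval_diff
        free_algebra_eval_scale free_algebra_eval_single L0_M0_symbol_simps
        vector_space.vector_space_assms(4)[OF vector_space_\<Phi>_scale] mult.commute
        intro!: free_algebra_diff_closed single_in_free_algebra)
  ultimately show ?thesis using F.genideal_minimal assms by blast
qed

lemma free_algebra_eval_surj:
  obtains p where "p \<in> carrier (free_algebra L0_M0_span)" "free_algebra_eval p = f"
proof -
  let ?F = "free_algebra L0_M0_span"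
  interpret F: ring ?F by (rule ring_free_algebra)
  have ops: "p \<oplus>\<^bsub>?F\<^esub> q = p + q" "p \<otimes>\<^bsub>?F\<^esub> q = p * q" for p q
    by (simp_all add: free_algebra_def)
  have const: "Poly_Mapping.single (Word []) c \<in> carrier ?F"
    "free_algebra_eval (Poly_Mapping.single (Word []) c) = \<Phi>_scale c 1" for c
    by (simp_all add: single_in_free_algebra free_algebra_eval_single)
  have letter: "bvec (Word [x]) \<in> carrier ?F" "free_algebra_eval (bvec (Word [x])) = L0_M0_symbol x"
    if "x \<in> L0_M0_span" for x
    using that by (simp_all add: single_in_free_algebra free_algebra_eval_single \<Phi>_scale_def flip: one_pCons)
  have mult: "\<exists>r\<in>carrier ?F. free_algebra_eval r = free_algebra_eval p * free_algebra_eval q"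
    if "p \<in> carrier ?F" "q \<in> carrier ?F" for p q
    using F.m_closed[OF that] by (metis ops(2) free_algebra_eval_mult)
  have "\<exists>p\<in>carrier ?F. free_algebra_eval p = f"
  proof (induction f rule: bipoly_induct)
    case one
    show ?case using const[of 1] by (intro bexI[of _ "bvec (Word [])"]) (simp_all add: \<Phi>_scale_def flip: one_pCons)
  next
    case (add f g)
    then show ?case using F.a_closed by (metis ops(1) free_algebra_eval_add)
  next
    case (scale c f)
    then obtain p where "p \<in> carrier ?F" "free_algebra_eval p = f" by blast
    then show ?case using mult[OF const(1), of p c] by (simp add: const \<Phi>_scale_def)
  next
    case (s f)
    then obtain p where "p \<in> carrier ?F" "free_algebra_eval p = f" by blast
    then show ?case using mult[OF letter(1), of "bvec (BL 0)" p] by (simp add: letter L0_M0_symbol_simps)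
  next
    case (t f)
    then obtain p where "p \<in> carrier ?F" "free_algebra_eval p = f" by blast
    then show ?case using mult[OF letter(1), of "bvec (BM 0)" p] by (simp add: letter L0_M0_symbol_simps)
  qed
  then show ?thesis using that by blast
qed

section \<open>Identifying a free module of rank one with \<open>\<complex>[s,t]\<close>\<close>

lemma fold_coeffs_pCons_0:
  assumes "g 0 0 = 0"
  shows "fold_coeffs g (pCons c p) 0 = g c (fold_coeffs g p 0)"
  using assms by (cases "p = 0 \<and> c = 0") (auto simp: fold_coeffs_def cCons_def)

locale bms_module = lie_module fs_scale bms_bracket scale act
  for scale :: "complex \<Rightarrow> 'v::ab_group_add \<Rightarrow> 'v" and act :: "bms \<Rightarrow> 'v \<Rightarrow> 'v"
begin

text \<open>Horner schemes for \<open>p(M\<^sub>0) v\<close> and \<open>f(L\<^sub>0,M\<^sub>0) v\<close>.\<close>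

definition eval_M0 :: "'v \<Rightarrow> complex poly \<Rightarrow> 'v" where
  "eval_M0 v p = fold_coeffs (\<lambda>c u. scale c v + act (bvec (BM 0)) u) p 0"

definition eval_L0_M0 :: "'v \<Rightarrow> complex poly poly \<Rightarrow> 'v" where
  "eval_L0_M0 v f = fold_coeffs (\<lambda>p u. eval_M0 v p + act (bvec (BL 0)) u) f 0"

lemma eval_M0_simps:
  "eval_M0 v 0 = 0"
  "eval_M0 v (pCons c p) = scale c v + act (bvec (BM 0)) (eval_M0 v p)"
  unfolding eval_M0_def by (simp, subst fold_coeffs_pCons_0) simp_all

lemma eval_L0_M0_simps:
  "eval_L0_M0 v 0 = 0"
  "eval_L0_M0 v (pCons p f) = eval_M0 v p + act (bvec (BL 0)) (eval_L0_M0 v f)"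
  unfolding eval_L0_M0_def by (simp, subst fold_coeffs_pCons_0) (simp_all add: eval_M0_simps)

lemma eval_M0_add: "eval_M0 v (p + q) = eval_M0 v p + eval_M0 v q"
  by (induction p q rule: poly_induct2)
    (simp_all add: eval_M0_simps act_add_right V.scale_left_distrib algebra_simps)

lemma eval_M0_smult: "eval_M0 v (smult c p) = scale c (eval_M0 v p)"
  by (induction p) (simp_all add: eval_M0_simps act_scale_right V.scale_right_distrib)

lemma eval_L0_M0_add: "eval_L0_M0 v (f + g) = eval_L0_M0 v f + eval_L0_M0 v g"
  by (induction f g rule: poly_induct2)
    (simp_all add: eval_L0_M0_simps eval_M0_add act_add_right algebra_simps)

lemma eval_L0_M0_scale: "eval_L0_M0 v (\<Phi>_scale c f) = scale c (eval_L0_M0 v f)"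
  by (induction f)
    (simp_all add: \<Phi>_scale_def eval_L0_M0_simps eval_M0_smult act_scale_right V.scale_right_distrib)

lemma eval_L0_M0_one: "eval_L0_M0 v 1 = v"
  by (simp add: one_pCons eval_L0_M0_simps eval_M0_simps)

lemma eval_L0_M0_s: "eval_L0_M0 v (pS * f) = act (bvec (BL 0)) (eval_L0_M0 v f)"
  by (simp add: eval_L0_M0_simps eval_M0_simps)

lemma act_zero_left: "act 0 w = 0"
  using act_add_left[of 0 0 w] by simp

lemma L0_M0_commute: "act (bvec (BL 0)) (act (bvec (BM 0)) w) = act (bvec (BM 0)) (act (bvec (BL 0)) w)"
  using act_bracket[of "bvec (BL 0)" "bvec (BM 0)" w] by (simp add: L0_M0_span_bracket act_zero_left)

lemma eval_L0_M0_t: "eval_L0_M0 v (pT * f) = act (bvec (BM 0)) (eval_L0_M0 v f)"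
  by (induction f) (simp_all add: eval_L0_M0_simps eval_M0_simps act_add_right L0_M0_commute)

lemma eval_L0_M0_symbol:
  assumes "x \<in> L0_M0_span"
  shows "eval_L0_M0 v (L0_M0_symbol x * f) = act x (eval_L0_M0 v f)"
proof -
  let ?a = "Poly_Mapping.lookup x (BL 0)" and ?b = "Poly_Mapping.lookup x (BM 0)"
  have "L0_M0_symbol x * f = \<Phi>_scale ?a (pS * f) + \<Phi>_scale ?b (pT * f)"
    unfolding L0_M0_symbol_def by (simp only: \<Phi>_scale_def distrib_right mult_smult_left)
  then have "eval_L0_M0 v (L0_M0_symbol x * f) = act (fs_scale ?a (bvec (BL 0)) + fs_scale ?b (bvec (BM 0))) (eval_L0_M0 v f)"
    by (simp only: eval_L0_M0_add eval_L0_M0_scale eval_L0_M0_s eval_L0_M0_t act_add_left act_scale_left)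
  then show ?thesis by (simp only: L0_M0_span_expand[OF assms, symmetric])
qed

text \<open>The action of the free algebra on \<open>v\<close> factors through \<open>\<complex>[s,t]\<close>. It takes the part of the injectivity of
  \<open>U(\<complex>L\<^sub>0 \<oplus> \<complex>M\<^sub>0) \<rightarrow> \<complex>[s,t]\<close>.\<close>

lemma free_act_eq_eval:
  assumes "p \<in> carrier (free_algebra L0_M0_span)"
  shows "free_act p v = eval_L0_M0 v (free_algebra_eval p)"
proof -
  have zero: "eval_L0_M0 v 0 = 0" by (simp add: eval_L0_M0_simps)
  have word: "foldr act xs v = eval_L0_M0 v (prod_list (map L0_M0_symbol xs))" if "set xs \<subseteq> L0_M0_span" for xs
    using that by (induction xs) (simp_all add: eval_L0_M0_one eval_L0_M0_symbol)
  have sum: "eval_L0_M0 v (\<Sum>w\<in>W. g w) = (\<Sum>w\<in>W. eval_L0_M0 v (g w))" if "finite W" for g and W :: "bms word set"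
    using that by induction (simp_all add: zero eval_L0_M0_add)
  show ?thesis
    using assms
    by (simp add: free_act_def free_algebra_eval_def lin_ext_def sum eval_L0_M0_scale word free_algebra_carrier_iff)
qed

text \<open>The vector \<open>v\<close> is the basis element. Surjectivity of \<open>f \<mapsto> f(L\<^sub>0,M\<^sub>0) v\<close> follows since every element is \<open>u v\<close> with \<open>u\<close> in
  the enveloping algebra. For injectivity, lift \<open>f\<close> and \<open>g\<close> to the free algebra: by uniqueness of \<open>u\<close> the lifts
  are congruent modulo the defining ideal, on which the evaluation in \<open>\<complex>[s,t]\<close> vanishes.\<close>

lemma free_rank_one_imp_bij_eval:
  assumes "free_rank_one_over L0_M0_span"
  obtains v where "bij (eval_L0_M0 v)"
proof -
  let ?F = "free_algebra L0_M0_span"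
  let ?I = "Idl\<^bsub>?F\<^esub> (bms.enveloping_relations L0_M0_span)"
  interpret F: ring ?F by (rule ring_free_algebra)
  obtain v where v: "bij_betw (\<lambda>u. env_act u v) (carrier (bms.enveloping_algebra L0_M0_span)) UNIV"
    using assms unfolding free_rank_one_over_def by blast
  have carrier: "carrier (bms.enveloping_algebra L0_M0_span) = {?I +>\<^bsub>?F\<^esub> p | p. p \<in> carrier ?F}"
    by (auto simp: bms.enveloping_algebra_def FactRing_def A_RCOSETS_def')
  have act: "env_act (?I +>\<^bsub>?F\<^esub> p) v = eval_L0_M0 v (free_algebra_eval p)" if "p \<in> carrier ?F" for p
    using that by (simp add: env_act_coset subspace_L0_M0_span L0_M0_span_bracket free_act_eq_eval)
  have "surj (eval_L0_M0 v)"
    unfolding surj_def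
  proof
    fix w
    obtain u where "u \<in> carrier (bms.enveloping_algebra L0_M0_span)" "w = env_act u v"
      using v unfolding bij_betw_def by (metis UNIV_I imageE)
    then show "\<exists>f. w = eval_L0_M0 v f" using carrier act by auto
  qed
  moreover have "f = g" if eq: "eval_L0_M0 v f = eval_L0_M0 v g" for f g
  proof -
    obtain p where p: "p \<in> carrier ?F" "free_algebra_eval p = f" by (rule free_algebra_eval_surj)
    obtain q where q: "q \<in> carrier ?F" "free_algebra_eval q = g" by (rule free_algebra_eval_surj)
    have "?I +>\<^bsub>?F\<^esub> p = ?I +>\<^bsub>?F\<^esub> q"
    proof (rule inj_onD[OF bij_betw_imp_inj_on[OF v]])
      show "env_act (?I +>\<^bsub>?F\<^esub> p) v = env_act (?I +>\<^bsub>?F\<^esub> q) v"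
        using eq p q act by simp
    qed (use p q carrier in blast)+
    moreover have "?I +>\<^bsub>?F\<^esub> r = {j + r | j. j \<in> ?I}" for r
      by (auto simp: a_r_coset_def' free_algebra_def)
    ultimately have "{j + p | j. j \<in> ?I} = {j + q | j. j \<in> ?I}" by simp
    moreover have "0 \<in> ?I"
      by (auto simp: genideal_def free_algebra_def dest!: ideal.axioms(1) additive_subgroup.zero_closed)
    ultimately obtain j where "0 + p = j + q" "j \<in> ?I" by blast
    then show "f = g" using p q free_algebra_eval_ideal[of j] free_algebra_eval_add[of j q] by simp
  qed
  ultimately show ?thesis using that[of v] by (simp add: bij_def inj_def)
qed

end

section \<open>Classification\<close>

text \<open>Transporting the action along \<open>f \<mapsto> f(L\<^sub>0,M\<^sub>0) v\<close> makes \<open>L\<^sub>0\<close> and \<open>M\<^sub>0\<close> the multiplications by \<open>s\<close> and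
  \<open>t\<close>, and then the action is literally that of some \<open>\<Phi>\<close>; the isomorphism is the inverse of the transport.\<close>

theorem theorem3p2:
  fixes scale :: "complex \<Rightarrow> 'v::ab_group_add \<Rightarrow> 'v"
    and act :: "bms \<Rightarrow> 'v \<Rightarrow> 'v"
  assumes "lie_module fs_scale bms_bracket scale act"
    and "lie_module.free_rank_one_over fs_scale bms_bracket scale act L0_M0_span"
  shows "\<exists>l \<alpha> \<beta> \<gamma> h. l \<noteq> 0 \<and>
    lie_module_isomorphic scale act \<Phi>_scale (\<Phi>_act l \<alpha> \<beta> \<gamma> h)"
proof -
  interpret bms_module scale act using assms(1) by (simp add: bms_module_def)
  obtain v where bij: "bij (eval_L0_M0 v)" by (rule free_rank_one_imp_bij_eval[OF assms(2)])
  define \<psi> where "\<psi> = eval_L0_M0 v"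
  define \<phi> where "\<phi> = inv_into UNIV \<psi>"
  have \<phi>\<psi> [simp]: "\<phi> (\<psi> f) = f" for f using bij by (simp add: \<phi>_def \<psi>_def bij_is_inj)
  have \<psi>\<phi> [simp]: "\<psi> (\<phi> w) = w" for w using bij by (simp add: \<phi>_def \<psi>_def bij_is_surj surj_f_inv_f)
  have \<phi>_add: "\<phi> (w + w') = \<phi> w + \<phi> w'" for w w'
    by (metis \<phi>\<psi> \<psi>\<phi> \<psi>_def eval_L0_M0_add)
  have \<phi>_scale: "\<phi> (scale c w) = \<Phi>_scale c (\<phi> w)" for c w
    by (metis \<phi>\<psi> \<psi>\<phi> \<psi>_def eval_L0_M0_scale)
  have \<phi>_diff: "\<phi> (w - w') = \<phi> w - \<phi> w'" for w w'
    using \<phi>_add[of "w - w'" w'] by simp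
  define A where "A x f = \<phi> (act x (\<psi> f))" for x f
  have \<psi>_add: "\<psi> (f + g) = \<psi> f + \<psi> g" and \<psi>_scale: "\<psi> (\<Phi>_scale c f) = scale c (\<psi> f)" for f g c
    by (simp_all add: \<psi>_def eval_L0_M0_add eval_L0_M0_scale)
  have "lie_module fs_scale bms_bracket \<Phi>_scale A"
    by (intro lie_module.intro bms.lie_algebra_axioms vector_space_\<Phi>_scale lie_module_axioms.intro)
      (simp_all add: A_def \<phi>_add \<phi>_scale \<phi>_diff \<psi>_add \<psi>_scale act_add_left act_add_right act_scale_left
        act_scale_right act_bracket)
  then interpret A: bms_module_on_polys A
  proof (intro bms_module_on_polys.intro bms_module_on_polys_axioms.intro)
    show "A (bvec (BL 0)) f = pS * f" "A (bvec (BM 0)) f = pT * f" for f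
      unfolding A_def \<psi>_def eval_L0_M0_s[symmetric] eval_L0_M0_t[symmetric] by (simp_all only: \<phi>\<psi> flip: \<psi>_def)
  qed
  obtain l \<alpha> \<beta> \<gamma> h where l: "l \<noteq> 0" and A: "\<And>x f. A x f = \<Phi>_act l \<alpha> \<beta> \<gamma> h x f"
    using A.equals_\<Phi> by blast
  have "Vector_Spaces.linear scale \<Phi>_scale \<phi>"
    using V.vector_space_axioms vector_space_\<Phi>_scale by (simp add: Vector_Spaces.linear_iff \<phi>_add \<phi>_scale)
  moreover have "bij \<phi>" using bij by (simp add: \<phi>_def \<psi>_def bij_imp_bij_inv)
  moreover have "\<phi> (act x w) = \<Phi>_act l \<alpha> \<beta> \<gamma> h x (\<phi> w)" for x w
    using A[of x "\<phi> w"] by (simp add: A_def)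
  ultimately show ?thesis using l unfolding lie_module_isomorphic_def by blast
qed

end
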